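(* Let $R$ be a commutative Noetherian ring and $\{\mathfrak{p}_i\}_{i \ge 1}$ a countable set of prime ideals of $R$ with no containment relation (that is, $\mathfrak{p}_i \not\subseteq \mathfrak{p}_j$ for all $i \ne j$). Consider the formal power series ring $R[[X]]$ in one variable, and set $S = R[[X]] \setminus \bigcup_{i \ge 1} \mathfrak{p}_i R[[X]]$ and $T = R[[X]]_S$, the localization of $R[[X]]$ at the multiplicative set $S$. Then $R \to T$ is a flat extension and $\mathrm{Max}(T) = \{\mathfrak{p}_i T\}_{i \ge 1}$.
   Context: $\mathrm{Max}(T)$ denotes the set of maximal ideals of $T$. For an ideal $\mathfrak{p}$ of $R$ and an $R$-algebra $A$, $\mathfrak{p}A$ denotes the extended ideal, i.e. the ideal of $A$ generated by the image of $\mathfrak{p}$. The map $R \to T$ is the composite of the natural maps $R \to R[[X]] \to R[[X]]_S = T$; "flat extension" means that $T$ is flat as an $R$-module via this map. *)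

theory Defs
  imports "HOL-Algebra.Algebra"
begin

section \<open>Formal power series over a ring\<close>

text \<open>The library type \<open>'a fps\<close> only covers type-class rings, whereas here the coefficient
  ring is an arbitrary ring with a carrier; a power series is its coefficient sequence.\<close>

definition ps_ring :: "('a, 'r) ring_scheme \<Rightarrow> (nat \<Rightarrow> 'a) ring" where
  "ps_ring R = \<lparr>
     carrier = {f. \<forall>n. f n \<in> carrier R},
     monoid.mult = (\<lambda>f g n. \<Oplus>\<^bsub>R\<^esub>i\<in>{..n}. f i \<otimes>\<^bsub>R\<^esub> g (n - i)),
     monoid.one = (\<lambda>n. if n = 0 then \<one>\<^bsub>R\<^esub> else \<zero>\<^bsub>R\<^esub>),
     ring.zero = (\<lambda>n. \<zero>\<^bsub>R\<^esub>),
     ring.add = (\<lambda>f g n. f n \<oplus>\<^bsub>R\<^esub> g n)\<rparr>"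

definition ps_const :: "('a, 'r) ring_scheme \<Rightarrow> 'a \<Rightarrow> (nat \<Rightarrow> 'a)" where
  "ps_const R r = (\<lambda>n. if n = 0 then r else \<zero>\<^bsub>R\<^esub>)"

lemma (in ring) ps_mult_assoc_aux:
  fixes a b c :: "nat \<Rightarrow> 'a"
  assumes "a \<in> UNIV \<rightarrow> carrier R" "b \<in> UNIV \<rightarrow> carrier R" "c \<in> UNIV \<rightarrow> carrier R"
  shows "k \<le> n \<Longrightarrow>
      (\<Oplus>j \<in> {..k}. (\<Oplus>i \<in> {..j}. a i \<otimes> b (j-i)) \<otimes> c (n-j)) =
      (\<Oplus>j \<in> {..k}. a j \<otimes> (\<Oplus>i \<in> {..k-j}. b i \<otimes> c (n-j-i)))"
  (is "_ \<Longrightarrow> ?eq k")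
proof (induct k)
  case 0
  with assms show ?case by (simp add: Pi_def m_assoc)
next
  case (Suc k)
  then have "k \<le> n" by arith
  from this have "?eq k" by (rule Suc)
  with assms show ?case
    by (simp cong: finsum_cong add: Suc_diff_le Pi_def l_distr r_distr m_assoc)
      (simp cong: finsum_cong add: Pi_def a_ac finsum_ldistr m_assoc)
qed

lemma (in cring) ps_mult_comm_aux:
  fixes a b :: "nat \<Rightarrow> 'a"
  assumes "a \<in> UNIV \<rightarrow> carrier R" "b \<in> UNIV \<rightarrow> carrier R"
  shows "k \<le> n \<Longrightarrow> (\<Oplus>i \<in> {..k}. a i \<otimes> b (n-i)) = (\<Oplus>i \<in> {..k}. a (k-i) \<otimes> b (i+n-k))"
proof (induct k)
  case 0
  with assms show ?case by (simp add: Pi_def)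
next
  case (Suc k)
  with assms show ?case
    by (subst (2) finsum_Suc2) (simp add: Pi_def a_comm)+
qed

lemma (in cring) ps_const_mult:
  assumes "a \<in> carrier R" "\<And>n. g n \<in> carrier R"
  shows "(\<Oplus>i\<in>{..n}. ps_const R a i \<otimes> g (n - i)) = a \<otimes> g n"
proof -
  have "(\<Oplus>i\<in>{..n}. ps_const R a i \<otimes> g (n - i)) =
      (\<Oplus>i\<in>{..n}. if 0 = i then a \<otimes> g (n - i) else \<zero>)"
    using assms by (intro finsum_cong') (auto simp: ps_const_def)
  also have "\<dots> = a \<otimes> g (n - 0)"
    using assms by (subst finsum_singleton) auto
  finally show ?thesis by simp
qed

lemma (in cring) cring_ps_ring: "cring (ps_ring R)"
proof (rule cringI)
  show "abelian_group (ps_ring R)"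
  proof (rule abelian_groupI)
    fix f assume "f \<in> carrier (ps_ring R)"
    then show "\<exists>g\<in>carrier (ps_ring R). g \<oplus>\<^bsub>ps_ring R\<^esub> f = \<zero>\<^bsub>ps_ring R\<^esub>"
      by (intro bexI[of _ "\<lambda>n. \<ominus> f n"]) (auto simp: ps_ring_def l_neg)
  qed (auto simp: ps_ring_def a_ac)
  have comm: "f \<otimes>\<^bsub>ps_ring R\<^esub> g = g \<otimes>\<^bsub>ps_ring R\<^esub> f"
    if "f \<in> carrier (ps_ring R)" "g \<in> carrier (ps_ring R)" for f g
  proof
    fix n
    show "(f \<otimes>\<^bsub>ps_ring R\<^esub> g) n = (g \<otimes>\<^bsub>ps_ring R\<^esub> f) n"
      using that ps_mult_comm_aux[of f g n n]
      by (auto simp: ps_ring_def Pi_def m_comm intro!: finsum_cong')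
  qed
  have one: "\<one>\<^bsub>ps_ring R\<^esub> \<otimes>\<^bsub>ps_ring R\<^esub> f = f" if "f \<in> carrier (ps_ring R)" for f
    using that ps_const_mult[of \<one> f] by (auto simp: ps_ring_def ps_const_def)
  show "comm_monoid (ps_ring R)"
  proof (rule comm_monoidI)
    fix f g h
    assume fgh: "f \<in> carrier (ps_ring R)" "g \<in> carrier (ps_ring R)" "h \<in> carrier (ps_ring R)"
    show "f \<otimes>\<^bsub>ps_ring R\<^esub> g \<otimes>\<^bsub>ps_ring R\<^esub> h = f \<otimes>\<^bsub>ps_ring R\<^esub> (g \<otimes>\<^bsub>ps_ring R\<^esub> h)"
    proof
      fix n
      show "(f \<otimes>\<^bsub>ps_ring R\<^esub> g \<otimes>\<^bsub>ps_ring R\<^esub> h) n = (f \<otimes>\<^bsub>ps_ring R\<^esub> (g \<otimes>\<^bsub>ps_ring R\<^esub> h)) n"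
        using fgh ps_mult_assoc_aux[of f g h n n] by (auto simp: ps_ring_def Pi_def)
    qed
  qed (use comm one in \<open>auto simp: ps_ring_def\<close>)
  show "(f \<oplus>\<^bsub>ps_ring R\<^esub> g) \<otimes>\<^bsub>ps_ring R\<^esub> h =
      f \<otimes>\<^bsub>ps_ring R\<^esub> h \<oplus>\<^bsub>ps_ring R\<^esub> g \<otimes>\<^bsub>ps_ring R\<^esub> h"
    if "f \<in> carrier (ps_ring R)" "g \<in> carrier (ps_ring R)" "h \<in> carrier (ps_ring R)" for f g h
  proof
    fix n
    show "((f \<oplus>\<^bsub>ps_ring R\<^esub> g) \<otimes>\<^bsub>ps_ring R\<^esub> h) n =
        (f \<otimes>\<^bsub>ps_ring R\<^esub> h \<oplus>\<^bsub>ps_ring R\<^esub> g \<otimes>\<^bsub>ps_ring R\<^esub> h) n"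
      using that by (auto simp: ps_ring_def l_distr finsum_addf Pi_def)
  qed
qed

lemma (in cring) ps_const_ring_hom: "ps_const R \<in> ring_hom R (ps_ring R)"
proof (rule ring_hom_memI)
  fix a b assume ab: "a \<in> carrier R" "b \<in> carrier R"
  show "ps_const R (a \<otimes> b) = ps_const R a \<otimes>\<^bsub>ps_ring R\<^esub> ps_const R b"
  proof
    fix n
    show "ps_const R (a \<otimes> b) n = (ps_const R a \<otimes>\<^bsub>ps_ring R\<^esub> ps_const R b) n"
      using ab ps_const_mult[of a "ps_const R b" n] by (simp add: ps_ring_def) (simp add: ps_const_def)
  qed
qed (auto simp: ps_ring_def ps_const_def)


section \<open>Localization at a multiplicative subset\<close>

definition loc_rel :: "('a, 'r) ring_scheme \<Rightarrow> 'a set \<Rightarrow> (('a \<times> 'a) \<times> ('a \<times> 'a)) set" where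
  "loc_rel A S = {((a, s), (b, t)) | a s b t.
     a \<in> carrier A \<and> s \<in> S \<and> b \<in> carrier A \<and> t \<in> S \<and>
     (\<exists>u\<in>S. u \<otimes>\<^bsub>A\<^esub> (a \<otimes>\<^bsub>A\<^esub> t \<ominus>\<^bsub>A\<^esub> b \<otimes>\<^bsub>A\<^esub> s) = \<zero>\<^bsub>A\<^esub>)}"

definition loc_frac :: "('a, 'r) ring_scheme \<Rightarrow> 'a set \<Rightarrow> 'a \<Rightarrow> 'a \<Rightarrow> ('a \<times> 'a) set" where
  "loc_frac A S a s = loc_rel A S `` {(a, s)}"

text \<open>The operations take the union over all representatives; it is a single class whenever
  \<open>S\<close> is multiplicatively closed (see \<open>loc_mult_frac\<close> and \<open>loc_add_frac\<close> below).\<close>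

definition localization :: "('a, 'r) ring_scheme \<Rightarrow> 'a set \<Rightarrow> ('a \<times> 'a) set ring" where
  "localization A S = \<lparr>
     carrier = (carrier A \<times> S) // loc_rel A S,
     monoid.mult = (\<lambda>x y. \<Union>(a, s)\<in>x. \<Union>(b, t)\<in>y. loc_frac A S (a \<otimes>\<^bsub>A\<^esub> b) (s \<otimes>\<^bsub>A\<^esub> t)),
     monoid.one = loc_frac A S \<one>\<^bsub>A\<^esub> \<one>\<^bsub>A\<^esub>,
     ring.zero = loc_frac A S \<zero>\<^bsub>A\<^esub> \<one>\<^bsub>A\<^esub>,
     ring.add = (\<lambda>x y. \<Union>(a, s)\<in>x. \<Union>(b, t)\<in>y.
        loc_frac A S (a \<otimes>\<^bsub>A\<^esub> t \<oplus>\<^bsub>A\<^esub> b \<otimes>\<^bsub>A\<^esub> s) (s \<otimes>\<^bsub>A\<^esub> t))\<rparr>"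

definition loc_map :: "('a, 'r) ring_scheme \<Rightarrow> 'a set \<Rightarrow> 'a \<Rightarrow> ('a \<times> 'a) set" where
  "loc_map A S a = loc_frac A S a \<one>\<^bsub>A\<^esub>"


lemma (in cring) equiv_loc_rel:
  assumes S: "submonoid S R"
  shows "equiv (carrier R \<times> S) (loc_rel R S)"
proof (rule equivI)
  have SR: "s \<in> carrier R" if "s \<in> S" for s
    using that submonoid.subset[OF S] by auto
  show "loc_rel R S \<subseteq> (carrier R \<times> S) \<times> (carrier R \<times> S)"
    by (auto simp: loc_rel_def)
  show "refl_on (carrier R \<times> S) (loc_rel R S)"
    using submonoid.one_closed[OF S] SR by (auto simp: refl_on_def loc_rel_def a_minus_def r_neg)
  show "sym (loc_rel R S)"
  proof (rule symI, clarsimp simp: loc_rel_def)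
    fix a s b t u
    assume *: "a \<in> carrier R" "s \<in> S" "b \<in> carrier R" "t \<in> S" "u \<in> S"
      "u \<otimes> (a \<otimes> t \<ominus> b \<otimes> s) = \<zero>"
    have "u \<otimes> (b \<otimes> s \<ominus> a \<otimes> t) = \<ominus> (u \<otimes> (a \<otimes> t \<ominus> b \<otimes> s))"
      using *(1-5) SR by algebra
    then show "\<exists>u\<in>S. u \<otimes> (b \<otimes> s \<ominus> a \<otimes> t) = \<zero>"
      using * by auto
  qed
  show "trans (loc_rel R S)"
  proof (rule transI, clarsimp simp: loc_rel_def)
    fix a s b t c w u v
    assume *: "a \<in> carrier R" "s \<in> S" "b \<in> carrier R" "t \<in> S" "c \<in> carrier R" "w \<in> S"
      "u \<in> S" "v \<in> S"
      and u: "u \<otimes> (a \<otimes> t \<ominus> b \<otimes> s) = \<zero>" and v: "v \<otimes> (b \<otimes> w \<ominus> c \<otimes> t) = \<zero>"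
    have c: "s \<in> carrier R" "t \<in> carrier R" "w \<in> carrier R" "u \<in> carrier R" "v \<in> carrier R"
      using * SR by auto
    have "(u \<otimes> v \<otimes> t) \<otimes> (a \<otimes> w \<ominus> c \<otimes> s) =
        (v \<otimes> w) \<otimes> (u \<otimes> (a \<otimes> t \<ominus> b \<otimes> s)) \<oplus> (u \<otimes> s) \<otimes> (v \<otimes> (b \<otimes> w \<ominus> c \<otimes> t))"
      using *(1,3,5) c by algebra
    also have "\<dots> = \<zero>"
      using c by (simp add: u v)
    finally show "\<exists>u\<in>S. u \<otimes> (a \<otimes> w \<ominus> c \<otimes> s) = \<zero>"
      using * submonoid.m_closed[OF S] by blast
  qed
qed

lemma (in cring) loc_frac_eq_iff:
  assumes "submonoid S R" "a \<in> carrier R" "s \<in> S" "b \<in> carrier R" "t \<in> S"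
  shows "loc_frac R S a s = loc_frac R S b t \<longleftrightarrow> (\<exists>u\<in>S. u \<otimes> (a \<otimes> t \<ominus> b \<otimes> s) = \<zero>)"
proof -
  have "loc_frac R S a s = loc_frac R S b t \<longleftrightarrow> ((a, s), (b, t)) \<in> loc_rel R S"
    unfolding loc_frac_def using assms by (intro eq_equiv_class_iff[OF equiv_loc_rel]) auto
  with assms show ?thesis
    by (auto simp: loc_rel_def)
qed

lemma (in cring) carrier_localization:
  "carrier (localization R S) = {loc_frac R S a s | a s. a \<in> carrier R \<and> s \<in> S}"
  by (auto simp: localization_def loc_frac_def quotient_def)

lemma (in cring) loc_rel_mult:
  assumes S: "submonoid S R"
    and "((a, s), (a', s')) \<in> loc_rel R S" "((b, t), (b', t')) \<in> loc_rel R S"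
  shows "loc_frac R S (a \<otimes> b) (s \<otimes> t) = loc_frac R S (a' \<otimes> b') (s' \<otimes> t')"
    and "loc_frac R S (a \<otimes> t \<oplus> b \<otimes> s) (s \<otimes> t) = loc_frac R S (a' \<otimes> t' \<oplus> b' \<otimes> s') (s' \<otimes> t')"
proof -
  obtain u v where *: "a \<in> carrier R" "s \<in> S" "a' \<in> carrier R" "s' \<in> S"
      "b \<in> carrier R" "t \<in> S" "b' \<in> carrier R" "t' \<in> S" "u \<in> S" "v \<in> S"
    and u: "u \<otimes> (a \<otimes> s' \<ominus> a' \<otimes> s) = \<zero>" and v: "v \<otimes> (b \<otimes> t' \<ominus> b' \<otimes> t) = \<zero>"
    using assms by (auto simp: loc_rel_def)
  have c: "s \<in> carrier R" "s' \<in> carrier R" "t \<in> carrier R" "t' \<in> carrier R"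
      "u \<in> carrier R" "v \<in> carrier R"
    using * submonoid.subset[OF S] by auto
  note mem = submonoid.m_closed[OF S]
  have aux: "(u \<otimes> v) \<otimes> (x \<otimes> z \<ominus> y \<otimes> w) =
        (v \<otimes> z) \<otimes> (u \<otimes> (x \<ominus> y)) \<oplus> (u \<otimes> y) \<otimes> (v \<otimes> (z \<ominus> w))"
      "(u \<otimes> v) \<otimes> ((x \<otimes> d \<oplus> z \<otimes> e) \<ominus> (y \<otimes> d \<oplus> w \<otimes> e)) =
        (v \<otimes> d) \<otimes> (u \<otimes> (x \<ominus> y)) \<oplus> (u \<otimes> e) \<otimes> (v \<otimes> (z \<ominus> w))"
    if "x \<in> carrier R" "y \<in> carrier R" "z \<in> carrier R" "w \<in> carrier R"
      "d \<in> carrier R" "e \<in> carrier R" for x y z w d e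
    using that c(5,6) by algebra+
  have "(u \<otimes> v) \<otimes> ((a \<otimes> b) \<otimes> (s' \<otimes> t') \<ominus> (a' \<otimes> b') \<otimes> (s \<otimes> t)) =
      (u \<otimes> v) \<otimes> ((a \<otimes> s') \<otimes> (b \<otimes> t') \<ominus> (a' \<otimes> s) \<otimes> (b' \<otimes> t))"
    using *(1,3,5,7) c by (simp add: m_ac)
  also have "\<dots> = \<zero>"
    using * c by (subst aux(1)) (simp_all add: u v)
  finally show "loc_frac R S (a \<otimes> b) (s \<otimes> t) = loc_frac R S (a' \<otimes> b') (s' \<otimes> t')"
    using * mem by (subst loc_frac_eq_iff[OF S]) auto
  have "(u \<otimes> v) \<otimes> ((a \<otimes> t \<oplus> b \<otimes> s) \<otimes> (s' \<otimes> t') \<ominus> (a' \<otimes> t' \<oplus> b' \<otimes> s') \<otimes> (s \<otimes> t)) =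
      (u \<otimes> v) \<otimes> (((a \<otimes> s') \<otimes> (t \<otimes> t') \<oplus> (b \<otimes> t') \<otimes> (s \<otimes> s')) \<ominus>
        ((a' \<otimes> s) \<otimes> (t \<otimes> t') \<oplus> (b' \<otimes> t) \<otimes> (s \<otimes> s')))"
  proof -
    have "(a \<otimes> t \<oplus> b \<otimes> s) \<otimes> (s' \<otimes> t') =
        (a \<otimes> s') \<otimes> (t \<otimes> t') \<oplus> (b \<otimes> t') \<otimes> (s \<otimes> s')"
      "(a' \<otimes> t' \<oplus> b' \<otimes> s') \<otimes> (s \<otimes> t) =
        (a' \<otimes> s) \<otimes> (t \<otimes> t') \<oplus> (b' \<otimes> t) \<otimes> (s \<otimes> s')"
      using *(1,3,5,7) c by (simp_all add: l_distr r_distr m_ac)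
    then show ?thesis
      by simp
  qed
  also have "\<dots> = \<zero>"
    using * c by (subst aux(2)) (simp_all add: u v)
  finally show
    "loc_frac R S (a \<otimes> t \<oplus> b \<otimes> s) (s \<otimes> t) = loc_frac R S (a' \<otimes> t' \<oplus> b' \<otimes> s') (s' \<otimes> t')"
    using * c mem by (subst loc_frac_eq_iff[OF S]) auto
qed

lemma (in cring)
  assumes S: "submonoid S R" and "a \<in> carrier R" "s \<in> S" "b \<in> carrier R" "t \<in> S"
  shows loc_mult_frac: "loc_frac R S a s \<otimes>\<^bsub>localization R S\<^esub> loc_frac R S b t =
      loc_frac R S (a \<otimes> b) (s \<otimes> t)"
    and loc_add_frac: "loc_frac R S a s \<oplus>\<^bsub>localization R S\<^esub> loc_frac R S b t =
      loc_frac R S (a \<otimes> t \<oplus> b \<otimes> s) (s \<otimes> t)"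
proof -
  have self: "(a, s) \<in> loc_frac R S a s" "(b, t) \<in> loc_frac R S b t"
    using equiv_class_self[OF equiv_loc_rel[OF S]] assms by (auto simp: loc_frac_def)
  have const: "(\<Union>(a', s')\<in>loc_frac R S a s. \<Union>(b', t')\<in>loc_frac R S b t. F a' s' b' t') = F a s b t"
    if "\<And>a' s' b' t'. ((a, s), (a', s')) \<in> loc_rel R S \<Longrightarrow> ((b, t), (b', t')) \<in> loc_rel R S \<Longrightarrow>
      F a s b t = F a' s' b' t'"
    for F :: "'a \<Rightarrow> 'a \<Rightarrow> 'a \<Rightarrow> 'a \<Rightarrow> ('a \<times> 'a) set"
  proof (intro equalityI subsetI)
    fix z assume "z \<in> (\<Union>(a', s')\<in>loc_frac R S a s. \<Union>(b', t')\<in>loc_frac R S b t. F a' s' b' t')"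
    then obtain a' s' b' t' where "((a, s), (a', s')) \<in> loc_rel R S" "((b, t), (b', t')) \<in> loc_rel R S"
      "z \<in> F a' s' b' t'"
      by (auto simp: loc_frac_def)
    then show "z \<in> F a s b t"
      using that by blast
  next
    fix z assume "z \<in> F a s b t"
    with self show "z \<in> (\<Union>(a', s')\<in>loc_frac R S a s. \<Union>(b', t')\<in>loc_frac R S b t. F a' s' b' t')"
      by blast
  qed
  show "loc_frac R S a s \<otimes>\<^bsub>localization R S\<^esub> loc_frac R S b t =
      loc_frac R S (a \<otimes> b) (s \<otimes> t)"
    unfolding localization_def monoid.simps
    by (rule const) (rule loc_rel_mult(1)[OF S])
  show "loc_frac R S a s \<oplus>\<^bsub>localization R S\<^esub> loc_frac R S b t =
      loc_frac R S (a \<otimes> t \<oplus> b \<otimes> s) (s \<otimes> t)"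
    unfolding localization_def ring.simps
    by (rule const) (rule loc_rel_mult(2)[OF S])
qed

lemma (in cring) loc_frac_eqI:
  assumes S: "submonoid S R" and "a \<in> carrier R" "s \<in> S" "b \<in> carrier R" "t \<in> S"
    and "a \<otimes> t = b \<otimes> s"
  shows "loc_frac R S a s = loc_frac R S b t"
  using assms submonoid.one_closed[OF S] submonoid.subset[OF S]
  by (subst loc_frac_eq_iff[OF S]) (auto intro!: bexI[of _ \<one>] simp: a_minus_def r_neg subset_iff)

lemma (in cring) cring_localization:
  assumes S: "submonoid S R"
  shows "cring (localization R S)"
proof -
  let ?L = "localization R S"
  note mem [simp] = submonoid.m_closed[OF S] submonoid.one_closed[OF S]
  have SR: "s \<in> carrier R" if "s \<in> S" for s
    using that submonoid.subset[OF S] by auto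
  note [simp] = loc_mult_frac[OF S] loc_add_frac[OF S]
  have one: "\<one>\<^bsub>?L\<^esub> = loc_frac R S \<one> \<one>" and zero: "\<zero>\<^bsub>?L\<^esub> = loc_frac R S \<zero> \<one>"
    by (simp_all add: localization_def)
  have frac: thesis if "x \<in> carrier ?L"
    "\<And>a s. x = loc_frac R S a s \<Longrightarrow> a \<in> carrier R \<Longrightarrow> s \<in> S \<Longrightarrow> s \<in> carrier R \<Longrightarrow> thesis"
    for x thesis using that SR by (auto simp: carrier_localization)
  have fracI: "loc_frac R S a s \<in> carrier ?L" if "a \<in> carrier R" "s \<in> S" for a s
    using that by (auto simp: carrier_localization)
  show ?thesis
  proof (rule cringI)
    show "abelian_group ?L"
    proof (rule abelian_groupI)
      fix x y assume "x \<in> carrier ?L" "y \<in> carrier ?L"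
      then show "x \<oplus>\<^bsub>?L\<^esub> y \<in> carrier ?L"
        by (elim frac) (auto intro!: fracI)
    next
      show "\<zero>\<^bsub>?L\<^esub> \<in> carrier ?L" unfolding zero by (intro fracI) simp_all
    next
      fix x y z assume "x \<in> carrier ?L" "y \<in> carrier ?L" "z \<in> carrier ?L"
      then show "x \<oplus>\<^bsub>?L\<^esub> y \<oplus>\<^bsub>?L\<^esub> z = x \<oplus>\<^bsub>?L\<^esub> (y \<oplus>\<^bsub>?L\<^esub> z)"
        by (elim frac) (simp add: l_distr r_distr m_ac a_ac)
    next
      fix x y assume "x \<in> carrier ?L" "y \<in> carrier ?L"
      then show "x \<oplus>\<^bsub>?L\<^esub> y = y \<oplus>\<^bsub>?L\<^esub> x"
        by (elim frac) (simp add: l_distr r_distr m_ac a_ac)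
    next
      fix x assume "x \<in> carrier ?L"
      then show "\<zero>\<^bsub>?L\<^esub> \<oplus>\<^bsub>?L\<^esub> x = x"
        by (elim frac) (simp add: one zero)
    next
      fix x assume "x \<in> carrier ?L"
      then obtain a s where x: "x = loc_frac R S a s" "a \<in> carrier R" "s \<in> S"
        by (elim frac)
      have "loc_frac R S (\<ominus> a) s \<oplus>\<^bsub>?L\<^esub> x = loc_frac R S \<zero> (s \<otimes> s)"
        using x by (simp add: SR l_minus l_neg)
      also have "\<dots> = \<zero>\<^bsub>?L\<^esub>"
        unfolding zero using x by (intro loc_frac_eqI[OF S]) (simp_all add: SR)
      finally have "loc_frac R S (\<ominus> a) s \<oplus>\<^bsub>?L\<^esub> x = \<zero>\<^bsub>?L\<^esub>" .
      then show "\<exists>y\<in>carrier ?L. y \<oplus>\<^bsub>?L\<^esub> x = \<zero>\<^bsub>?L\<^esub>"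
        using x(2,3) by (intro bexI[of _ "loc_frac R S (\<ominus> a) s"] fracI) simp_all
    qed
    show "comm_monoid ?L"
    proof (rule comm_monoidI)
      fix x y assume "x \<in> carrier ?L" "y \<in> carrier ?L"
      then show "x \<otimes>\<^bsub>?L\<^esub> y \<in> carrier ?L"
        by (elim frac) (auto intro!: fracI)
    next
      show "\<one>\<^bsub>?L\<^esub> \<in> carrier ?L" unfolding one by (intro fracI) simp_all
    next
      fix x y z assume "x \<in> carrier ?L" "y \<in> carrier ?L" "z \<in> carrier ?L"
      then show "x \<otimes>\<^bsub>?L\<^esub> y \<otimes>\<^bsub>?L\<^esub> z = x \<otimes>\<^bsub>?L\<^esub> (y \<otimes>\<^bsub>?L\<^esub> z)"
        by (elim frac) (simp add: m_assoc)
    next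
      fix x assume "x \<in> carrier ?L"
      then show "\<one>\<^bsub>?L\<^esub> \<otimes>\<^bsub>?L\<^esub> x = x"
        by (elim frac) (simp add: one zero)
    next
      fix x y assume "x \<in> carrier ?L" "y \<in> carrier ?L"
      then show "x \<otimes>\<^bsub>?L\<^esub> y = y \<otimes>\<^bsub>?L\<^esub> x"
        by (elim frac) (simp add: m_comm)
    qed
    fix x y z assume "x \<in> carrier ?L" "y \<in> carrier ?L" "z \<in> carrier ?L"
    then show "(x \<oplus>\<^bsub>?L\<^esub> y) \<otimes>\<^bsub>?L\<^esub> z = x \<otimes>\<^bsub>?L\<^esub> z \<oplus>\<^bsub>?L\<^esub> y \<otimes>\<^bsub>?L\<^esub> z"
      by (elim frac) (simp, rule loc_frac_eqI[OF S], simp_all add: l_distr r_distr m_ac)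
  qed
qed

lemma (in cring) loc_map_ring_hom:
  assumes S: "submonoid S R"
  shows "loc_map R S \<in> ring_hom R (localization R S)"
proof (rule ring_hom_memI)
  fix a assume "a \<in> carrier R"
  then show "loc_map R S a \<in> carrier (localization R S)"
    using submonoid.one_closed[OF S] by (auto simp: loc_map_def carrier_localization)
next
  fix a b assume "a \<in> carrier R" "b \<in> carrier R"
  then show "loc_map R S (a \<otimes> b) = loc_map R S a \<otimes>\<^bsub>localization R S\<^esub> loc_map R S b"
    and "loc_map R S (a \<oplus> b) = loc_map R S a \<oplus>\<^bsub>localization R S\<^esub> loc_map R S b"
    using submonoid.one_closed[OF S]
    by (simp_all add: loc_map_def loc_mult_frac[OF S] loc_add_frac[OF S])
next
  show "loc_map R S \<one> = \<one>\<^bsub>localization R S\<^esub>"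
    by (simp add: loc_map_def localization_def)
qed


section \<open>Extended ideals and restriction of scalars\<close>

definition extended_ideal ::
    "('a \<Rightarrow> 'b) \<Rightarrow> ('b, 'r) ring_scheme \<Rightarrow> 'a set \<Rightarrow> 'b set" where
  "extended_ideal \<phi> A I = Idl\<^bsub>A\<^esub> (\<phi> ` I)"

definition scalar_restriction :: "('a \<Rightarrow> 'b) \<Rightarrow> ('b, 'r) ring_scheme \<Rightarrow> ('a, 'b) module" where
  "scalar_restriction \<phi> A = \<lparr>
     carrier = carrier A, monoid.mult = monoid.mult A, monoid.one = monoid.one A,
     ring.zero = ring.zero A, ring.add = ring.add A,
     smult = (\<lambda>r x. \<phi> r \<otimes>\<^bsub>A\<^esub> x)\<rparr>"


section \<open>Tensor products and flatness\<close>

definition module_hom ::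
    "('a, 'r) ring_scheme \<Rightarrow> ('a, 'm, 'x) module_scheme \<Rightarrow> ('a, 'n, 'y) module_scheme
      \<Rightarrow> ('m \<Rightarrow> 'n) set" where
  "module_hom R M N = {f \<in> carrier M \<rightarrow> carrier N.
     (\<forall>x\<in>carrier M. \<forall>y\<in>carrier M. f (x \<oplus>\<^bsub>M\<^esub> y) = f x \<oplus>\<^bsub>N\<^esub> f y) \<and>
     (\<forall>r\<in>carrier R. \<forall>x\<in>carrier M. f (r \<odot>\<^bsub>M\<^esub> x) = r \<odot>\<^bsub>N\<^esub> f x)}"

definition tensor_relations ::
    "('a, 'r) ring_scheme \<Rightarrow> ('a, 'm, 'x) module_scheme \<Rightarrow> ('a, 'n, 'y) module_scheme
      \<Rightarrow> ('m \<times> 'n \<Rightarrow>\<^sub>0 int) set" where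
  "tensor_relations R M N =
     {frag_of (x \<oplus>\<^bsub>M\<^esub> x', y) - frag_of (x, y) - frag_of (x', y) | x x' y.
        x \<in> carrier M \<and> x' \<in> carrier M \<and> y \<in> carrier N} \<union>
     {frag_of (x, y \<oplus>\<^bsub>N\<^esub> y') - frag_of (x, y) - frag_of (x, y') | x y y'.
        x \<in> carrier M \<and> y \<in> carrier N \<and> y' \<in> carrier N} \<union>
     {frag_of (r \<odot>\<^bsub>M\<^esub> x, y) - frag_of (x, r \<odot>\<^bsub>N\<^esub> y) | r x y.
        r \<in> carrier R \<and> x \<in> carrier M \<and> y \<in> carrier N}"

definition tensor_subgroup ::
    "('a, 'r) ring_scheme \<Rightarrow> ('a, 'm, 'x) module_scheme \<Rightarrow> ('a, 'n, 'y) module_scheme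
      \<Rightarrow> ('m \<times> 'n \<Rightarrow>\<^sub>0 int) set" where
  "tensor_subgroup R M N =
     generate (free_Abelian_group (carrier M \<times> carrier N)) (tensor_relations R M N)"

text \<open>Only the additive group of the tensor product is needed to express flatness.\<close>

definition tensor ::
    "('a, 'r) ring_scheme \<Rightarrow> ('a, 'm, 'x) module_scheme \<Rightarrow> ('a, 'n, 'y) module_scheme
      \<Rightarrow> ('m \<times> 'n \<Rightarrow>\<^sub>0 int) set monoid" where
  "tensor R M N =
     free_Abelian_group (carrier M \<times> carrier N) Mod tensor_subgroup R M N"

text \<open>\<open>tensor_map_left R M M' N f\<close> is the map \<open>f \<otimes> id\<close> from \<open>M \<otimes> N\<close> to \<open>M' \<otimes> N\<close>:
  the class of a formal sum of pairs \<open>(x, y)\<close> goes to the class of the corresponding formal sum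
  of pairs \<open>(f x, y)\<close> (again written as a union over representatives).\<close>

definition tensor_map_left ::
    "('a, 'r) ring_scheme \<Rightarrow> ('a, 'm, 'x) module_scheme \<Rightarrow> ('a, 'k, 'z) module_scheme
      \<Rightarrow> ('a, 'n, 'y) module_scheme \<Rightarrow> ('m \<Rightarrow> 'k)
      \<Rightarrow> ('m \<times> 'n \<Rightarrow>\<^sub>0 int) set \<Rightarrow> ('k \<times> 'n \<Rightarrow>\<^sub>0 int) set" where
  "tensor_map_left R M M' N f C =
     (\<Union>c\<in>C. tensor_subgroup R M' N #>\<^bsub>free_Abelian_group (carrier M' \<times> carrier N)\<^esub>
        frag_extend (\<lambda>(x, y). frag_of (f x, y)) c)"

lemma tensor_relations_subset:
  assumes M: "module R M" and N: "module R N"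
  shows "tensor_relations R M N \<subseteq> carrier (free_Abelian_group (carrier M \<times> carrier N))"
proof -
  interpret M: module R M by fact
  interpret N: module R N by fact
  have diff: "a - b \<in> carrier (free_Abelian_group K)"
    if "a \<in> carrier (free_Abelian_group K)" "b \<in> carrier (free_Abelian_group K)"
    for a b :: "'x \<Rightarrow>\<^sub>0 int" and K
    using that keys_diff[of a b] by simp blast
  show ?thesis
    unfolding tensor_relations_def by safe (intro diff; simp)+
qed

lemma tensor_map_left_coset:
  assumes M: "module R M" and M': "module R M'" and N: "module R N" and f: "f \<in> module_hom R M M'"
    and c: "Poly_Mapping.keys c \<subseteq> carrier M \<times> carrier N"
  shows "tensor_map_left R M M' N f
      (tensor_subgroup R M N #>\<^bsub>free_Abelian_group (carrier M \<times> carrier N)\<^esub> c) =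
    tensor_subgroup R M' N #>\<^bsub>free_Abelian_group (carrier M' \<times> carrier N)\<^esub>
      frag_extend (\<lambda>(x, y). frag_of (f x, y)) c"
proof -
  interpret M: module R M by fact
  interpret M': module R M' by fact
  interpret N: module R N by fact
  let ?F = "free_Abelian_group (carrier M \<times> carrier N)"
  let ?F' = "free_Abelian_group (carrier M' \<times> carrier N)"
  let ?h = "frag_extend (\<lambda>(x, y). frag_of (f x, y))"
  have fM: "f x \<in> carrier M'" if "x \<in> carrier M" for x
    using f that by (auto simp: module_hom_def)
  have rel_sub: "tensor_relations R M N \<subseteq> carrier ?F"
    using M N by (rule tensor_relations_subset)
  have rel_sub': "tensor_relations R M' N \<subseteq> carrier ?F'"
    using M' N by (rule tensor_relations_subset)
  interpret H: subgroup "tensor_subgroup R M N" ?F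
    unfolding tensor_subgroup_def
    by (rule group.generate_is_subgroup[OF group_free_Abelian_group rel_sub])
  interpret H': subgroup "tensor_subgroup R M' N" ?F'
    unfolding tensor_subgroup_def
    by (rule group.generate_is_subgroup[OF group_free_Abelian_group rel_sub'])
  have hrel: "?h r \<in> tensor_relations R M' N" if r: "r \<in> tensor_relations R M N" for r
  proof -
    consider (add1) x x' y where "r = frag_of (x \<oplus>\<^bsub>M\<^esub> x', y) - frag_of (x, y) - frag_of (x', y)"
        "x \<in> carrier M" "x' \<in> carrier M" "y \<in> carrier N"
      | (add2) x y y' where "r = frag_of (x, y \<oplus>\<^bsub>N\<^esub> y') - frag_of (x, y) - frag_of (x, y')"
        "x \<in> carrier M" "y \<in> carrier N" "y' \<in> carrier N"
      | (scalar) a x y where "r = frag_of (a \<odot>\<^bsub>M\<^esub> x, y) - frag_of (x, a \<odot>\<^bsub>N\<^esub> y)"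
        "a \<in> carrier R" "x \<in> carrier M" "y \<in> carrier N"
      using r unfolding tensor_relations_def by blast
    then show ?thesis
    proof cases
      case add1
      then have "f (x \<oplus>\<^bsub>M\<^esub> x') = f x \<oplus>\<^bsub>M'\<^esub> f x'"
        using f by (simp add: module_hom_def)
      with add1 have "?h r = frag_of (f x \<oplus>\<^bsub>M'\<^esub> f x', y) - frag_of (f x, y) - frag_of (f x', y)"
        by (simp add: frag_extend_diff)
      with add1 fM show ?thesis
        unfolding tensor_relations_def by blast
    next
      case add2
      then have "?h r = frag_of (f x, y \<oplus>\<^bsub>N\<^esub> y') - frag_of (f x, y) - frag_of (f x, y')"
        by (simp add: frag_extend_diff)
      with add2 fM show ?thesis
        unfolding tensor_relations_def by blast
    next
      case scalar
      then have "f (a \<odot>\<^bsub>M\<^esub> x) = a \<odot>\<^bsub>M'\<^esub> f x"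
        using f by (simp add: module_hom_def)
      with scalar have "?h r = frag_of (a \<odot>\<^bsub>M'\<^esub> f x, y) - frag_of (f x, a \<odot>\<^bsub>N\<^esub> y)"
        by (simp add: frag_extend_diff)
      with scalar fM show ?thesis
        unfolding tensor_relations_def by blast
    qed
  qed
  have hsub: "?h r \<in> tensor_subgroup R M' N" if "r \<in> tensor_subgroup R M N" for r
    using that unfolding tensor_subgroup_def
  proof (induction r rule: generate.induct)
    case one
    show ?case
      using generate.one[of ?F' "tensor_relations R M' N"] by simp
  next
    case (incl r)
    then show ?case by (intro generate.incl hrel)
  next
    case (inv r)
    have "?h r \<in> carrier ?F'"
      by (rule subsetD[OF rel_sub' hrel[OF inv]])
    moreover have "r \<in> carrier ?F"
      by (rule subsetD[OF rel_sub inv])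
    moreover have "inv\<^bsub>?F'\<^esub> (?h r) \<in> generate ?F' (tensor_relations R M' N)"
      using inv by (intro generate.inv hrel)
    ultimately show ?case
      by (simp add: frag_extend_minus)
  next
    case (eng a b)
    from generate.eng[OF eng.IH] show ?case
      by (simp add: frag_extend_add)
  qed
  have hc: "?h d \<in> carrier ?F'" if "d \<in> carrier ?F" for d
  proof -
    have "Poly_Mapping.keys ((\<lambda>(x, y). frag_of (f x, y)) z) \<subseteq> carrier M' \<times> carrier N"
      if "z \<in> Poly_Mapping.keys d" for z
      using that \<open>d \<in> carrier ?F\<close> fM by (cases z) auto
    then have "Poly_Mapping.keys (?h d) \<subseteq> carrier M' \<times> carrier N"
      using keys_frag_extend[of "\<lambda>(x, y). frag_of (f x, y)" d] by (meson UN_least order_trans)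
    then show ?thesis
      by simp
  qed
  have cc: "c \<in> carrier ?F" using c by (simp add: free_Abelian_group_def)
  have eq: "tensor_subgroup R M' N #>\<^bsub>?F'\<^esub> ?h d = tensor_subgroup R M' N #>\<^bsub>?F'\<^esub> ?h c"
    if d: "d \<in> tensor_subgroup R M N #>\<^bsub>?F\<^esub> c" for d
  proof -
    obtain r where r: "r \<in> tensor_subgroup R M N" "d = r + c"
      using d by (auto simp: r_coset_def)
    have "?h d \<in> tensor_subgroup R M' N #>\<^bsub>?F'\<^esub> ?h c"
      using hsub[OF r(1)] by (auto simp: r_coset_def r(2) frag_extend_add)
    then show ?thesis
      using group.repr_independence[OF group_free_Abelian_group _ hc[OF cc] H'.subgroup_axioms]
      by simp
  qed
  moreover have "c \<in> tensor_subgroup R M N #>\<^bsub>?F\<^esub> c"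
    using group.rcos_self[OF group_free_Abelian_group cc H.subgroup_axioms] .
  ultimately show ?thesis
    unfolding tensor_map_left_def by blast
qed

text \<open>HOL cannot quantify over types inside a formula, so the types \<open>'m\<close> and \<open>'k\<close> of the test
  modules are parameters; flatness is the assertion for all such types, that is, with
  \<open>'m\<close> and \<open>'k\<close> left as type variables of the theorem.\<close>

definition flat_module ::
    "'m itself \<Rightarrow> 'k itself \<Rightarrow> ('a, 'r) ring_scheme \<Rightarrow> ('a, 'n, 'y) module_scheme \<Rightarrow> bool" where
  "flat_module _ _ R N \<longleftrightarrow> module R N \<and>
     (\<forall>(M :: ('a, 'm) module) (M' :: ('a, 'k) module) f.
        module R M \<and> module R M' \<and> f \<in> module_hom R M M' \<and> inj_on f (carrier M) \<longrightarrow>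
        inj_on (tensor_map_left R M M' N f) (carrier (tensor R M N)))"

definition flat_extension ::
    "'m itself \<Rightarrow> 'k itself \<Rightarrow> ('a \<Rightarrow> 'b) \<Rightarrow> ('a, 'r) ring_scheme \<Rightarrow> ('b, 'q) ring_scheme
      \<Rightarrow> bool" where
  "flat_extension m k \<phi> R A \<longleftrightarrow>
     \<phi> \<in> ring_hom R A \<and> flat_module m k R (scalar_restriction \<phi> A)"

end

theory Submission
  imports Defs
begin

text \<open>Let \<open>A = R[[X]]\<close>. For finitely many power series \<open>y\<close> the vectors formed by their
  \<open>n\<close>-th coefficients span a finitely generated submodule, so there are \<open>N\<close> and series \<open>z\<^sub>k\<close> with
  \<open>y = \<Sum>k\<le>N. y\<^sub>k z\<^sub>k\<close> for all these \<open>y\<close> at once. The coefficients \<open>y\<^sub>k\<close> are linear in \<open>y\<close>, so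
  an element of \<open>M \<otimes> A\<close> vanishes as soon as its images under the coefficient maps
  \<open>M \<otimes> A \<rightarrow> M\<close> vanish; this makes \<open>A\<close>, and hence its localization, flat over \<open>R\<close>. It also shows
  that \<open>pA\<close> consists of the series with coefficients in \<open>p\<close>.

  If \<open>Q\<close> is an ideal of \<open>A\<close>, finitely many \<open>f\<^sub>j \<in> Q\<close> have coefficients generating the ideal of all
  coefficients of \<open>Q\<close>. A combination \<open>\<Sum>j. a\<^sub>j f\<^sub>j\<close> with suitable series \<open>a\<^sub>j\<close>, chosen coefficient by
  coefficient, avoids every \<open>p\<^sub>iA\<close> that does not contain all \<open>f\<^sub>j\<close>. So countable prime avoidance
  holds for the \<open>p\<^sub>iA\<close>, and the maximal ideals of \<open>T\<close> are read off from the ideals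
  of \<open>A\<close> contained in \<open>\<Union>i. p\<^sub>iA\<close>.\<close>

section \<open>Noetherian rings and finite column spaces\<close>

locale noetherian_cring = cring + noetherian_ring

text \<open>Among the ideals generated by finite subsets of \<open>B\<close> there is a maximal one,
  because in a Noetherian ring a nonempty chain of ideals contains its union. Adjoining a further
  element of \<open>B\<close> cannot enlarge it. Keeping the generators inside \<open>B\<close> lets
  them be traced back to entries of a sequence or to coefficients of given series.\<close>

lemma (in noetherian_ring) Idl_finite_subset:
  assumes B: "B \<subseteq> carrier R"
  obtains F where "finite F" "F \<subseteq> B" "Idl F = Idl B"
proof -
  define C where "C = {Idl F | F. finite F \<and> F \<subseteq> B}"
  have "C \<noteq> {}" and CI: "C \<subseteq> {I. ideal I R}"
    using B by (auto simp: C_def intro!: genideal_ideal)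
  moreover have "\<Union>D \<in> C" if "D \<noteq> {}" "subset.chain C D" for D
  proof -
    have "subset.chain {I. ideal I R} D"
      using that(2) CI unfolding pred_on.chain_def by auto
    then have "\<Union>D \<in> D"
      using that(1) by (rule ideal_chain_is_trivial[rotated])
    then show ?thesis
      using that(2) unfolding pred_on.chain_def by auto
  qed
  ultimately obtain M where "M \<in> C" and max: "\<And>I. I \<in> C \<Longrightarrow> M \<subseteq> I \<Longrightarrow> I = M"
    using subset_Zorn_nonempty[of C] by blast
  then obtain F where F: "finite F" "F \<subseteq> B" "M = Idl F"
    by (auto simp: C_def)
  have "b \<in> Idl F" if "b \<in> B" for b
  proof -
    have "Idl (insert b F) \<in> C"
      unfolding C_def using F that by (intro CollectI exI[of _ "insert b F"]) auto
    moreover have "Idl F \<subseteq> Idl (insert b F)"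
      using F B that by (intro subset_Idl_subset) auto
    ultimately have "Idl (insert b F) = Idl F"
      using max F(3) by blast
    then show ?thesis
      using genideal_self[of "insert b F"] F B that by blast
  qed
  then have "Idl B \<subseteq> Idl F"
    using F B by (intro genideal_minimal genideal_ideal) auto
  moreover have "Idl F \<subseteq> Idl B"
    using F B by (intro subset_Idl_subset) auto
  ultimately show thesis
    using that F by blast
qed

lemma (in ideal) finsum_mem:
  assumes "\<And>k. k \<in> K \<Longrightarrow> f k \<in> I"
  shows "(\<Oplus>k\<in>K. f k) \<in> I"
  using assms
proof (induction K rule: infinite_finite_induct)
  case (insert k K)
  then have "f \<in> K \<rightarrow> carrier R" "f k \<in> carrier R"
    using Icarr by auto
  with insert show ?case
    by (simp add: a_closed)
qed (auto simp: finsum_infinite)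

text \<open>The combinations \<open>?J\<close> form an ideal, and a Kronecker delta as coefficients
  shows that it contains every \<open>g k\<close>. The sum runs over indices and not over values, so
  \<open>g\<close> may repeat values.\<close>

lemma (in cring) Idl_image_lincomb:
  assumes K: "finite K" and g: "g \<in> K \<rightarrow> carrier R" and x: "x \<in> Idl (g ` K)"
  obtains b where "b \<in> K \<rightarrow> carrier R" "x = (\<Oplus>k\<in>K. b k \<otimes> g k)"
proof -
  let ?J = "{(\<Oplus>k\<in>K. b k \<otimes> g k) | b. b \<in> K \<rightarrow> carrier R}"
  have mem: "(\<lambda>k. b k \<otimes> g k) \<in> K \<rightarrow> carrier R" if "b \<in> K \<rightarrow> carrier R" for b
    using that g by auto
  have "ideal ?J R"
  proof (rule idealI)
    have "subgroup ?J (add_monoid R)"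
    proof (rule add.subgroupI)
      show "?J \<subseteq> carrier R"
        using mem by (auto intro!: finsum_closed)
      show "?J \<noteq> {}"
        by auto
    next
      fix a assume "a \<in> ?J"
      then obtain b where b: "b \<in> K \<rightarrow> carrier R" "a = (\<Oplus>k\<in>K. b k \<otimes> g k)"
        by auto
      have "\<ominus> a = \<ominus> \<one> \<otimes> a"
        using b mem by (simp add: l_minus finsum_closed)
      also have "\<dots> = (\<Oplus>k\<in>K. \<ominus> \<one> \<otimes> (b k \<otimes> g k))"
        using b mem K by (simp add: finsum_rdistr del: l_minus)
      also have "\<dots> = (\<Oplus>k\<in>K. (\<ominus> b k) \<otimes> g k)"
        using b g by (intro finsum_cong') (auto simp: l_minus Pi_def)
      finally show "\<ominus> a \<in> ?J"
        using b by (intro CollectI exI[of _ "\<lambda>k. \<ominus> b k"]) auto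
    next
      fix a a' assume "a \<in> ?J" "a' \<in> ?J"
      then obtain b b' where b: "b \<in> K \<rightarrow> carrier R" "a = (\<Oplus>k\<in>K. b k \<otimes> g k)"
        "b' \<in> K \<rightarrow> carrier R" "a' = (\<Oplus>k\<in>K. b' k \<otimes> g k)"
        by auto
      have "a \<oplus> a' = (\<Oplus>k\<in>K. b k \<otimes> g k \<oplus> b' k \<otimes> g k)"
        unfolding b using b mem by (subst finsum_addf) auto
      also have "\<dots> = (\<Oplus>k\<in>K. (b k \<oplus> b' k) \<otimes> g k)"
        using b g by (intro finsum_cong') (auto simp: l_distr Pi_def)
      finally show "a \<oplus> a' \<in> ?J"
        using b by (intro CollectI exI[of _ "\<lambda>k. b k \<oplus> b' k"]) auto
    qed
    then show "subgroup ?J (add_monoid R)" .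
  next
    fix a r assume "a \<in> ?J" and r: "r \<in> carrier R"
    then obtain b where b: "b \<in> K \<rightarrow> carrier R" "a = (\<Oplus>k\<in>K. b k \<otimes> g k)"
      by auto
    then have "r \<otimes> a = (\<Oplus>k\<in>K. r \<otimes> (b k \<otimes> g k))"
      using mem K r by (simp add: finsum_rdistr)
    also have "\<dots> = (\<Oplus>k\<in>K. (r \<otimes> b k) \<otimes> g k)"
      using b g r by (intro finsum_cong') (auto simp: m_assoc Pi_def)
    finally show ra: "r \<otimes> a \<in> ?J"
      using b r by (intro CollectI exI[of _ "\<lambda>k. r \<otimes> b k"]) auto
    have "a \<otimes> r = r \<otimes> a"
      using b r mem by (intro m_comm) (auto intro!: finsum_closed)
    with ra show "a \<otimes> r \<in> ?J"
      by simp
  qed (rule ring_axioms)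
  moreover have "g ` K \<subseteq> ?J"
  proof clarify
    fix j assume j: "j \<in> K"
    have "(\<Oplus>k\<in>K. (if j = k then \<one> else \<zero>) \<otimes> g k) = (\<Oplus>k\<in>K. if j = k then g k else \<zero>)"
      using g by (intro finsum_cong') (auto simp: Pi_def)
    also have "\<dots> = g j"
      using j K g by (intro finsum_singleton) auto
    finally show "\<exists>b. g j = (\<Oplus>k\<in>K. b k \<otimes> g k) \<and> b \<in> K \<rightarrow> carrier R"
      by (intro exI[of _ "\<lambda>k. if j = k then \<one> else \<zero>"]) auto
  qed
  ultimately have "Idl (g ` K) \<subseteq> ?J"
    by (rule genideal_minimal)
  with x that show thesis
    by blast
qed

text \<open>The ideal generated by all entries of \<open>w\<close> is generated by finitely many of
  them, hence by an initial segment. This is the one-row case of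
  \<open>column_space_finitely_generated\<close> and drives its induction.\<close>

lemma (in noetherian_cring) sequence_lincomb:
  assumes w: "\<And>n. w n \<in> carrier R"
  obtains b and N :: nat where "\<And>n k. b n k \<in> carrier R"
    "\<And>n :: nat. w n = (\<Oplus>k\<in>{..N}. b n k \<otimes> w k)"
proof -
  obtain F where F: "finite F" "F \<subseteq> range w" "Idl F = Idl (range w)"
    using Idl_finite_subset[of "range w"] w by blast
  obtain K where K: "finite K" "F = w ` K"
    using F(1,2) by (metis finite_subset_image subset_UNIV)
  \<comment> \<open>\<open>insert 0\<close> keeps \<open>Max\<close> meaningful when
    \<open>K\<close> is empty.\<close>
  define N where "N = Max (insert 0 K)"
  have "\<exists>b. b \<in> {..N} \<rightarrow> carrier R \<and> w n = (\<Oplus>k\<in>{..N}. b k \<otimes> w k)" for n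
  proof -
    have "w n \<in> Idl (w ` K)"
      using F(3) K(2) genideal_self[of "range w"] w by blast
    also have "\<dots> \<subseteq> Idl (w ` {..N})"
      using w K(1) by (intro subset_Idl_subset) (auto simp: N_def)
    finally obtain b where "b \<in> {..N} \<rightarrow> carrier R" "w n = (\<Oplus>k\<in>{..N}. b k \<otimes> w k)"
      by (rule Idl_image_lincomb[rotated 2]) (use w in auto)
    then show ?thesis
      by blast
  qed
  then obtain b where b: "\<And>n. b n \<in> {..N} \<rightarrow> carrier R"
      "\<And>n. w n = (\<Oplus>k\<in>{..N}. b n k \<otimes> w k)"
    by metis
  show thesis
  proof
    \<comment> \<open>Coefficients beyond \<open>N\<close> are replaced by zero so that they lie in
      the carrier for every \<open>k\<close>.\<close>
    show "(if k \<le> N then b n k else \<zero>) \<in> carrier R" for n k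
      using b(1) by auto
    show "w n = (\<Oplus>k\<in>{..N}. (if k \<le> N then b n k else \<zero>) \<otimes> w k)" for n
      unfolding b(2)[of n] by (rule finsum_cong') (use b(1) w in \<open>auto simp: Pi_def\<close>)
  qed
qed

lemma (in abelian_monoid) finsum_swap:
  assumes "finite K" "finite L" "\<And>i j. i \<in> K \<Longrightarrow> j \<in> L \<Longrightarrow> f i j \<in> carrier G"
  shows "(\<Oplus>i\<in>K. \<Oplus>j\<in>L. f i j) = (\<Oplus>j\<in>L. \<Oplus>i\<in>K. f i j)"
  using assms(1,3)
proof (induction K)
  case empty
  then show ?case by simp
next
  case (insert k K)
  have "(\<Oplus>i\<in>insert k K. \<Oplus>j\<in>L. f i j) = (\<Oplus>j\<in>L. f k j) \<oplus> (\<Oplus>i\<in>K. \<Oplus>j\<in>L. f i j)"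
    using insert by (subst finsum_insert) (auto intro!: finsum_closed)
  also have "\<dots> = (\<Oplus>j\<in>L. f k j \<oplus> (\<Oplus>i\<in>K. f i j))"
    using insert by (subst finsum_addf) (auto intro!: finsum_closed)
  also have "\<dots> = (\<Oplus>j\<in>L. \<Oplus>i\<in>insert k K. f i j)"
    using insert by (intro finsum_cong') (auto intro!: finsum_closed)
  finally show ?case .
qed

lemma (in abelian_monoid) finsum_atMost_extend:
  assumes "N \<le> (L :: nat)" "\<And>k. f k \<in> carrier G"
  shows "(\<Oplus>k\<in>{..L}. if k \<le> N then f k else \<zero>) = (\<Oplus>k\<in>{..N}. f k)"
  using assms by (intro add.finprod_mono_neutral_cong_right) auto

text \<open>In other words, the submodule of \<open>R\<^sup>Y\<close> spanned by the columns \<open>(y n)\<close>, \<open>y \<in> Y\<close>, is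
  generated by the first \<open>N + 1\<close> of them.\<close>

lemma (in noetherian_cring) column_space_finitely_generated:
  assumes "finite Y" "\<And>y n. y \<in> Y \<Longrightarrow> y n \<in> carrier R"
  obtains Z and N :: nat where "\<And>n k. Z n k \<in> carrier R"
    "\<And>y n. y \<in> Y \<Longrightarrow> y n = (\<Oplus>k\<in>{..N}. Z n k \<otimes> y k)"
proof -
  have "\<exists>N Z. (\<forall>n k. Z n k \<in> carrier R) \<and> (\<forall>y\<in>Y. \<forall>n. y n = (\<Oplus>k\<in>{..N}. Z n k \<otimes> y k))"
    using assms
  proof (induction Y)
    case empty
    show ?case by (intro exI[of _ 0] exI[of _ "\<lambda>_ _. \<zero>"]) auto
  next
    case (insert y0 Y)
    then obtain N Z where Z: "\<And>n k. Z n k \<in> carrier R"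
      "\<And>y n. y \<in> Y \<Longrightarrow> y n = (\<Oplus>k\<in>{..N}. Z n k \<otimes> y k)"
      by blast
    have y0: "y0 n \<in> carrier R" for n
      using insert.prems by auto
    have S0: "(\<Oplus>k\<in>{..N}. Z n k \<otimes> y0 k) \<in> carrier R" for n
      using Z(1) y0 by (intro finsum_closed) auto
    \<comment> \<open>\<open>w\<close> is the error left when the representation found for
      \<open>Y\<close> is applied to \<open>y0\<close>; a finite representation \<open>b\<close> of
      \<open>w\<close> itself will correct it.\<close>
    define w where "w n = y0 n \<ominus> (\<Oplus>k\<in>{..N}. Z n k \<otimes> y0 k)" for n
    have wc: "w n \<in> carrier R" for n
      unfolding w_def using y0 S0 by (intro minus_closed)
    obtain b M where b: "\<And>n k. b n k \<in> carrier R" "\<And>n. w n = (\<Oplus>i\<in>{..M}. b n i \<otimes> w i)"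
      using sequence_lincomb[of w] wc by blast
    define L where "L = max N M"
    define Z' where "Z' n k = (if k \<le> N then Z n k else \<zero>)" for n k
    define b' where "b' n k = (if k \<le> M then b n k else \<zero>)" for n k
    have c: "Z' n k \<in> carrier R" "b' n k \<in> carrier R" for n k
      by (auto simp: Z'_def b'_def Z b)
    \<comment> \<open>As matrices, 1 - \<open>Z''\<close> = (1 - \<open>b'\<close>)(1 -
      \<open>Z'\<close>): the factor 1 - \<open>Z'\<close> kills the rows in \<open>Y\<close> and
      turns \<open>y0\<close> into \<open>w\<close>, which 1 - \<open>b'\<close> then kills. Both
      matrices are padded by zeros to the common bound \<open>L\<close>.\<close>
    define Z'' where "Z'' n k = Z' n k \<oplus> (b' n k \<ominus> (\<Oplus>i\<in>{..L}. b' n i \<otimes> Z' i k))" for n k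
    have c'': "(\<Oplus>i\<in>{..L}. b' n i \<otimes> Z' i k) \<in> carrier R" "Z'' n k \<in> carrier R" for n k
      unfolding Z''_def using c by (auto intro!: finsum_closed a_closed minus_closed)
    have cancel: "u = (u \<ominus> v) \<oplus> v" "u = v \<oplus> (u \<ominus> v)"
        "(a \<oplus> (u \<ominus> v)) \<otimes> d \<oplus> v \<otimes> d = a \<otimes> d \<oplus> u \<otimes> d"
      if "u \<in> carrier R" "v \<in> carrier R" "a \<in> carrier R" "d \<in> carrier R" for u v a d
      using that by algebra+
    have "y n = (\<Oplus>k\<in>{..L}. Z'' n k \<otimes> y k)" if y: "y \<in> insert y0 Y" for y n
    proof -
      have yc: "y n \<in> carrier R" for n
        using insert.prems y by blast
      define r where "r n = y n \<ominus> (\<Oplus>k\<in>{..L}. Z' n k \<otimes> y k)" for n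
      have r: "r n = y n \<ominus> (\<Oplus>k\<in>{..N}. Z n k \<otimes> y k)" for n
      proof -
        have "(\<Oplus>k\<in>{..L}. Z' n k \<otimes> y k) = (\<Oplus>k\<in>{..L}. if k \<le> N then Z n k \<otimes> y k else \<zero>)"
          using Z yc by (intro finsum_cong') (auto simp: Z'_def)
        also have "\<dots> = (\<Oplus>k\<in>{..N}. Z n k \<otimes> y k)"
          using Z yc by (intro finsum_atMost_extend) (auto simp: L_def)
        finally show ?thesis by (simp add: r_def)
      qed
      have Sc: "(\<Oplus>k\<in>{..L}. Z' n k \<otimes> y k) \<in> carrier R" for n
        using c yc by (intro finsum_closed) auto
      have rc: "r n \<in> carrier R" for n
        unfolding r_def using Sc yc by auto
      \<comment> \<open>The residual \<open>r\<close> is zero for a row in \<open>Y\<close> and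
        equals \<open>w\<close> for \<open>y0\<close>; both are reproduced by
        \<open>b'\<close>.\<close>
      have rb: "r n = (\<Oplus>i\<in>{..L}. b' n i \<otimes> r i)"
      proof -
        have "(\<Oplus>i\<in>{..L}. b' n i \<otimes> r i) = (\<Oplus>i\<in>{..L}. if i \<le> M then b n i \<otimes> r i else \<zero>)"
          using b rc by (intro finsum_cong') (auto simp: b'_def)
        also have "\<dots> = (\<Oplus>i\<in>{..M}. b n i \<otimes> r i)"
          using b rc by (intro finsum_atMost_extend) (auto simp: L_def)
        also have "\<dots> = r n"
        proof (cases "y \<in> Y")
          case True
          then have "r n = \<zero>" for n
            unfolding r using Z(2)[OF True, symmetric] yc by (simp add: a_minus_def r_neg)
          with b show ?thesis by simp
        next
          case False
          with y have "y = y0" by simp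
          then have "r = w"
            by (simp add: fun_eq_iff r w_def)
          then show ?thesis
            using b(2)[of n] by simp
        qed
        finally show ?thesis ..
      qed
      \<comment> \<open>Associativity of the matrix product, b'(Z'y) = (b'Z')y.\<close>
      have double: "(\<Oplus>i\<in>{..L}. b' n i \<otimes> (\<Oplus>k\<in>{..L}. Z' i k \<otimes> y k)) =
          (\<Oplus>k\<in>{..L}. (\<Oplus>i\<in>{..L}. b' n i \<otimes> Z' i k) \<otimes> y k)" (is "?lhs = ?rhs")
      proof -
        have "?lhs = (\<Oplus>i\<in>{..L}. \<Oplus>k\<in>{..L}. b' n i \<otimes> Z' i k \<otimes> y k)"
          using c yc by (intro finsum_cong') (auto simp: finsum_rdistr m_assoc Pi_def)
        also have "\<dots> = (\<Oplus>k\<in>{..L}. \<Oplus>i\<in>{..L}. b' n i \<otimes> Z' i k \<otimes> y k)"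
          using c yc by (intro finsum_swap) auto
        also have "\<dots> = ?rhs"
          using c yc by (intro finsum_cong') (auto simp: finsum_ldistr Pi_def)
        finally show ?thesis .
      qed
      have "(\<Oplus>i\<in>{..L}. b' n i \<otimes> y i) =
          (\<Oplus>i\<in>{..L}. b' n i \<otimes> r i \<oplus> b' n i \<otimes> (\<Oplus>k\<in>{..L}. Z' i k \<otimes> y k))"
      proof (intro finsum_cong')
        fix i
        have "y i = r i \<oplus> (\<Oplus>k\<in>{..L}. Z' i k \<otimes> y k)"
          unfolding r_def using yc Sc by (rule cancel(1)) auto
        then show "b' n i \<otimes> y i = b' n i \<otimes> r i \<oplus> b' n i \<otimes> (\<Oplus>k\<in>{..L}. Z' i k \<otimes> y k)"
          using c rc Sc by (metis r_distr)
      qed (use c rc Sc in auto)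
      also have "\<dots> = r n \<oplus> (\<Oplus>k\<in>{..L}. (\<Oplus>i\<in>{..L}. b' n i \<otimes> Z' i k) \<otimes> y k)"
        unfolding double[symmetric] rb using c rc Sc by (intro finsum_addf) auto
      finally have B: "(\<Oplus>i\<in>{..L}. b' n i \<otimes> y i) =
        r n \<oplus> (\<Oplus>k\<in>{..L}. (\<Oplus>i\<in>{..L}. b' n i \<otimes> Z' i k) \<otimes> y k)" (is "_ = _ \<oplus> ?D") .
      have Dc: "?D \<in> carrier R" and Tc: "(\<Oplus>k\<in>{..L}. Z'' n k \<otimes> y k) \<in> carrier R"
        using c'' yc by (auto intro!: finsum_closed)
      \<comment> \<open>\<open>?D\<close> is added on both sides and cancelled at the end, so that
        no subtraction has to pass through a finite sum.\<close>
      have "(\<Oplus>k\<in>{..L}. Z'' n k \<otimes> y k) \<oplus> ?D =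
          (\<Oplus>k\<in>{..L}. Z'' n k \<otimes> y k \<oplus> (\<Oplus>i\<in>{..L}. b' n i \<otimes> Z' i k) \<otimes> y k)"
        using c'' yc by (intro finsum_addf[symmetric]) auto
      also have "\<dots> = (\<Oplus>k\<in>{..L}. Z' n k \<otimes> y k \<oplus> b' n k \<otimes> y k)"
      proof (intro finsum_cong')
        fix k
        show "Z'' n k \<otimes> y k \<oplus> (\<Oplus>i\<in>{..L}. b' n i \<otimes> Z' i k) \<otimes> y k = Z' n k \<otimes> y k \<oplus> b' n k \<otimes> y k"
          unfolding Z''_def using c c''(1) yc by (intro cancel(3))
      qed (use c yc in auto)
      also have "\<dots> = (\<Oplus>k\<in>{..L}. Z' n k \<otimes> y k) \<oplus> (\<Oplus>i\<in>{..L}. b' n i \<otimes> y i)"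
        using c yc by (intro finsum_addf) auto
      also have "\<dots> = ((\<Oplus>k\<in>{..L}. Z' n k \<otimes> y k) \<oplus> r n) \<oplus> ?D"
        using B Sc rc Dc by (simp add: a_assoc)
      finally have "(\<Oplus>k\<in>{..L}. Z'' n k \<otimes> y k) = (\<Oplus>k\<in>{..L}. Z' n k \<otimes> y k) \<oplus> r n"
        using Tc Dc Sc rc by (simp add: add.right_cancel)
      also have "\<dots> = y n"
        unfolding r_def using yc Sc by (rule cancel(2)[symmetric]) auto
      finally show ?thesis ..
    qed
    with c'' show ?case by blast
  qed
  with that show thesis by metis
qed


section \<open>Ideals of power series and countable avoidance\<close>

lemma (in ideal) minus_mem: "a \<in> I \<Longrightarrow> b \<in> I \<Longrightarrow> a \<ominus> b \<in> I"
  by (simp add: a_minus_def)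

section \<open>Power series coefficient by coefficient\<close>

lemma ps_carrier_iff: "f \<in> carrier (ps_ring R) \<longleftrightarrow> (\<forall>n. f n \<in> carrier R)"
  by (simp add: ps_ring_def)

lemma ps_add_nth: "(f \<oplus>\<^bsub>ps_ring R\<^esub> g) n = f n \<oplus>\<^bsub>R\<^esub> g n"
  by (simp add: ps_ring_def)

lemma ps_mult_nth: "(f \<otimes>\<^bsub>ps_ring R\<^esub> g) n = (\<Oplus>\<^bsub>R\<^esub>i\<in>{..n}. f i \<otimes>\<^bsub>R\<^esub> g (n - i))"
  by (simp add: ps_ring_def)

lemma ps_zero_nth: "\<zero>\<^bsub>ps_ring R\<^esub> n = \<zero>\<^bsub>R\<^esub>"
  by (simp add: ps_ring_def)

lemma ps_one_nth: "\<one>\<^bsub>ps_ring R\<^esub> n = (if n = 0 then \<one>\<^bsub>R\<^esub> else \<zero>\<^bsub>R\<^esub>)"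
  by (simp add: ps_ring_def)

lemma (in cring) ps_const_closed: "a \<in> carrier R \<Longrightarrow> ps_const R a \<in> carrier (ps_ring R)"
  by (simp add: ps_const_def ps_carrier_iff)

lemma (in cring) ps_const_mult_nth:
  "a \<in> carrier R \<Longrightarrow> g \<in> carrier (ps_ring R) \<Longrightarrow> (ps_const R a \<otimes>\<^bsub>ps_ring R\<^esub> g) n = a \<otimes> g n"
  by (simp add: ps_const_mult ps_carrier_iff ps_mult_nth)

lemma (in cring) ps_finsum_nth:
  assumes "F \<in> K \<rightarrow> carrier (ps_ring R)"
  shows "(\<Oplus>\<^bsub>ps_ring R\<^esub>k\<in>K. F k) n = (\<Oplus>k\<in>K. F k n)"
proof -
  interpret A: cring "ps_ring R" by (rule cring_ps_ring)
  show ?thesis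
    using assms
  proof (induction K rule: infinite_finite_induct)
    case (insert k K)
    then have "(\<lambda>k. F k n) \<in> K \<rightarrow> carrier R" "F k n \<in> carrier R"
      by (auto simp: ps_carrier_iff Pi_def)
    with insert show ?case
      by (simp add: ps_add_nth)
  qed (auto simp: ps_zero_nth)
qed

text \<open>For fixed \<open>k\<close> the entries \<open>Z n k\<close> are the coefficients of the
  series \<open>z k\<close>. The scalars in the resulting decomposition are coefficients of
  \<open>y\<close>, hence linear in \<open>y\<close>, while \<open>z\<close> and \<open>N\<close>
  serve all of \<open>Y\<close> at once.\<close>

lemma (in noetherian_cring) ps_decomposition:
  assumes "finite Y" "Y \<subseteq> carrier (ps_ring R)"
  obtains z and N :: nat where "\<And>k. z k \<in> carrier (ps_ring R)"
    "\<And>y. y \<in> Y \<Longrightarrow> y = (\<Oplus>\<^bsub>ps_ring R\<^esub>k\<in>{..N}. ps_const R (y k) \<otimes>\<^bsub>ps_ring R\<^esub> z k)"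
proof -
  interpret A: cring "ps_ring R" by (rule cring_ps_ring)
  have Y: "y n \<in> carrier R" if "y \<in> Y" for y n
    using assms(2) that by (auto simp: ps_carrier_iff)
  obtain Z and N :: nat where Z: "\<And>n k. Z n k \<in> carrier R"
    "\<And>y n. y \<in> Y \<Longrightarrow> y n = (\<Oplus>k\<in>{..N}. Z n k \<otimes> y k)"
    using column_space_finitely_generated[OF assms(1)] Y by blast
  define z where "z k n = Z n k" for k n
  have z: "z k \<in> carrier (ps_ring R)" for k
    using Z(1) by (simp add: z_def ps_carrier_iff)
  show thesis
  proof (rule that[of z N, OF z])
    fix y assume y: "y \<in> Y"
    show "y = (\<Oplus>\<^bsub>ps_ring R\<^esub>k\<in>{..N}. ps_const R (y k) \<otimes>\<^bsub>ps_ring R\<^esub> z k)"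
    proof
      fix n
      have "y n = (\<Oplus>k\<in>{..N}. Z n k \<otimes> y k)"
        using y by (rule Z(2))
      also have "\<dots> = (\<Oplus>k\<in>{..N}. (ps_const R (y k) \<otimes>\<^bsub>ps_ring R\<^esub> z k) n)"
        using Y[OF y] z Z(1)
        by (intro finsum_cong') (auto simp: ps_const_mult_nth m_comm z_def)
      also have "\<dots> = (\<Oplus>\<^bsub>ps_ring R\<^esub>k\<in>{..N}. ps_const R (y k) \<otimes>\<^bsub>ps_ring R\<^esub> z k) n"
        using Y[OF y] z by (intro ps_finsum_nth[symmetric]) (auto intro: ps_const_closed)
      finally show "y n = (\<Oplus>\<^bsub>ps_ring R\<^esub>k\<in>{..N}. ps_const R (y k) \<otimes>\<^bsub>ps_ring R\<^esub> z k) n" .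
    qed
  qed
qed

text \<open>This is \<open>p[[X]]\<close>. For an ideal of a Noetherian ring it is the extension of
  \<open>p\<close> to the power series ring, in a form where membership is tested coefficient by
  coefficient.\<close>

definition ps_ideal :: "'a set \<Rightarrow> (nat \<Rightarrow> 'a) set" where
  "ps_ideal p = {f. \<forall>n. f n \<in> p}"

lemma (in cring) ideal_ps_ideal:
  assumes "ideal p R"
  shows "ideal (ps_ideal p) (ps_ring R)"
proof -
  interpret A: cring "ps_ring R" by (rule cring_ps_ring)
  interpret p: ideal p R by fact
  have sub: "ps_ideal p \<subseteq> carrier (ps_ring R)"
    using p.Icarr by (auto simp: ps_ideal_def ps_carrier_iff)
  have mult: "g \<otimes>\<^bsub>ps_ring R\<^esub> f \<in> ps_ideal p"
    if "f \<in> ps_ideal p" "g \<in> carrier (ps_ring R)" for f g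
    using that by (auto simp: ps_ideal_def ps_carrier_iff ps_mult_nth intro!: p.finsum_mem p.I_l_closed)
  show ?thesis
  proof (rule idealI)
    show "subgroup (ps_ideal p) (add_monoid (ps_ring R))"
    proof (rule A.add.subgroupI)
      show "ps_ideal p \<noteq> {}"
        by (auto simp: ps_ideal_def intro!: exI[of _ "\<lambda>_. \<zero>"])
    next
      fix f assume f: "f \<in> ps_ideal p"
      have "\<ominus>\<^bsub>ps_ring R\<^esub> f = \<ominus>\<^bsub>ps_ring R\<^esub> \<one>\<^bsub>ps_ring R\<^esub> \<otimes>\<^bsub>ps_ring R\<^esub> f"
        using f sub by (auto simp: A.l_minus)
      then show "\<ominus>\<^bsub>ps_ring R\<^esub> f \<in> ps_ideal p"
        using mult[OF f] by simp
    qed (use sub in \<open>auto simp: ps_ideal_def ps_add_nth\<close>)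
    fix f g assume fg: "f \<in> ps_ideal p" "g \<in> carrier (ps_ring R)"
    then show "g \<otimes>\<^bsub>ps_ring R\<^esub> f \<in> ps_ideal p" by (rule mult)
    then show "f \<otimes>\<^bsub>ps_ring R\<^esub> g \<in> ps_ideal p"
      using fg sub by (subst A.m_comm) auto
  qed (rule A.ring_axioms)
qed

text \<open>By \<open>ps_decomposition\<close> a series with coefficients in \<open>p\<close> is a
  finite sum of some of its own coefficients times series. The Noetherian hypothesis enters here by
  reducing infinitely many coefficients to finitely many.\<close>

lemma (in noetherian_cring) extended_ideal_ps_const:
  assumes "ideal p R"
  shows "extended_ideal (ps_const R) (ps_ring R) p = ps_ideal p"
proof
  interpret A: cring "ps_ring R" by (rule cring_ps_ring)
  interpret p: ideal p R by fact
  interpret P: ideal "ps_ideal p" "ps_ring R" by (rule ideal_ps_ideal[OF assms])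
  have "ps_const R ` p \<subseteq> ps_ideal p"
    by (auto simp: ps_ideal_def ps_const_def)
  then show "extended_ideal (ps_const R) (ps_ring R) p \<subseteq> ps_ideal p"
    unfolding extended_ideal_def by (intro A.genideal_minimal P.ideal_axioms)
  have sub: "ps_const R ` p \<subseteq> carrier (ps_ring R)"
    using p.Icarr by (auto intro: ps_const_closed)
  interpret E: ideal "extended_ideal (ps_const R) (ps_ring R) p" "ps_ring R"
    unfolding extended_ideal_def by (rule A.genideal_ideal[OF sub])
  show "ps_ideal p \<subseteq> extended_ideal (ps_const R) (ps_ring R) p"
  proof
    fix f assume f: "f \<in> ps_ideal p"
    have coeff: "ps_const R (f k) \<in> extended_ideal (ps_const R) (ps_ring R) p" for k
      unfolding extended_ideal_def using f A.genideal_self[OF sub] by (auto simp: ps_ideal_def)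
    show "f \<in> extended_ideal (ps_const R) (ps_ring R) p"
    proof (rule ps_decomposition[of "{f}"])
      fix z and N :: nat
      assume z: "\<And>k. z k \<in> carrier (ps_ring R)"
        "\<And>y. y \<in> {f} \<Longrightarrow> y = (\<Oplus>\<^bsub>ps_ring R\<^esub>k\<in>{..N}. ps_const R (y k) \<otimes>\<^bsub>ps_ring R\<^esub> z k)"
      show ?thesis
        by (subst z(2)[OF singletonI]) (intro E.finsum_mem E.I_r_closed z(1) coeff)
    qed (use P.Icarr[OF f] in auto)
  qed
qed

text \<open>If \<open>f m\<close> and \<open>g n\<close> are the first coefficients outside
  \<open>p\<close>, the coefficient of the product at \<open>m + n\<close> is congruent to
  \<open>f m \<otimes> g n\<close> modulo \<open>p\<close>.\<close>

lemma (in cring) primeideal_ps_ideal: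
  assumes "primeideal p R"
  shows "primeideal (ps_ideal p) (ps_ring R)"
proof -
  interpret A: cring "ps_ring R" by (rule cring_ps_ring)
  interpret p: primeideal p R by fact
  interpret P: ideal "ps_ideal p" "ps_ring R"
    by (rule ideal_ps_ideal[OF p.ideal_axioms])
  show ?thesis
  proof (rule primeidealI)
    have "\<one>\<^bsub>ps_ring R\<^esub> \<notin> ps_ideal p"
    proof
      assume "\<one>\<^bsub>ps_ring R\<^esub> \<in> ps_ideal p"
      then have "\<one>\<^bsub>ps_ring R\<^esub> 0 \<in> p"
        unfolding ps_ideal_def by blast
      then show False
        using p.one_imp_carrier p.I_notcarr by (simp add: ps_one_nth)
    qed
    then show "carrier (ps_ring R) \<noteq> ps_ideal p"
      by auto
  next
    fix f g assume f: "f \<in> carrier (ps_ring R)" and g: "g \<in> carrier (ps_ring R)"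
      and fg: "f \<otimes>\<^bsub>ps_ring R\<^esub> g \<in> ps_ideal p"
    show "f \<in> ps_ideal p \<or> g \<in> ps_ideal p"
    proof (rule ccontr)
      assume "\<not> ?thesis"
      then have ex: "\<exists>m. f m \<notin> p" "\<exists>n. g n \<notin> p"
        by (auto simp: ps_ideal_def)
      define m where "m = (LEAST m. f m \<notin> p)"
      define n where "n = (LEAST n. g n \<notin> p)"
      have m: "f m \<notin> p" "\<And>i. i < m \<Longrightarrow> f i \<in> p" and n: "g n \<notin> p" "\<And>i. i < n \<Longrightarrow> g i \<in> p"
        unfolding m_def n_def using LeastI_ex[OF ex(1)] LeastI_ex[OF ex(2)] not_less_Least by auto
      have c: "f i \<in> carrier R" "g i \<in> carrier R" for i
        using f g by (auto simp: ps_carrier_iff)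
      let ?t = "\<lambda>i. f i \<otimes> g (m + n - i)"
      let ?r = "\<Oplus>i\<in>{..m + n} - {m}. ?t i"
      have "(f \<otimes>\<^bsub>ps_ring R\<^esub> g) (m + n) = (\<Oplus>i\<in>insert m ({..m + n} - {m}). ?t i)"
        by (simp add: ps_mult_nth insert_absorb)
      also have "\<dots> = ?t m \<oplus> ?r"
        using c by (subst finsum_insert) auto
      finally have sum: "f m \<otimes> g n \<oplus> ?r \<in> p"
        using fg by (simp add: ps_ideal_def) metis
      have r: "?r \<in> p"
      proof (rule p.finsum_mem)
        fix i assume "i \<in> {..m + n} - {m}"
        then consider "i < m" | "m + n - i < n"
          by fastforce
        then show "?t i \<in> p"
          using m(2) n(2) c by cases (auto intro: p.I_l_closed p.I_r_closed)
      qed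
      have "f m \<otimes> g n = (f m \<otimes> g n \<oplus> ?r) \<ominus> ?r"
        using c p.Icarr[OF r] by (simp add: a_minus_def a_assoc r_neg)
      then have "f m \<otimes> g n \<in> p"
        using p.minus_mem[OF sum r] by simp
      then show False
        using p.I_prime c m(1) n(1) by blast
    qed
  qed (rule P.ideal_axioms A.is_cring)+
qed

text \<open>A common multiplier \<open>a\<close> for all \<open>i\<close> is built coefficient by coefficient: at stage \<open>i\<close>
  adding a monomial of \<open>a\<close> beyond the part fixed so far makes one coefficient of
  \<open>f + a g\<close> leave \<open>p i\<close>, and the part of \<open>a\<close> on which this coefficient depends is then fixed.\<close>

lemma (in cring) ps_avoid_pair:
  fixes p :: "nat \<Rightarrow> 'a set"
  assumes p: "\<And>i. i \<in> I \<Longrightarrow> ideal (p i) R"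
    and f: "f \<in> carrier (ps_ring R)" and g: "g \<in> carrier (ps_ring R)"
  obtains a where "a \<in> carrier (ps_ring R)"
    "\<And>i. i \<in> I \<Longrightarrow> f \<oplus>\<^bsub>ps_ring R\<^esub> a \<otimes>\<^bsub>ps_ring R\<^esub> g \<in> ps_ideal (p i) \<Longrightarrow>
       f \<in> ps_ideal (p i) \<and> g \<in> ps_ideal (p i)"
proof -
  interpret A: cring "ps_ring R" by (rule cring_ps_ring)
  let ?h = "\<lambda>a. f \<oplus>\<^bsub>ps_ring R\<^esub> a \<otimes>\<^bsub>ps_ring R\<^esub> g"
  \<comment> \<open>These are the indices whose ideal must be escaped; for the other indices in
    \<open>I\<close> the claimed conclusion holds anyway.\<close>
  define bad where "bad i \<longleftrightarrow> i \<in> I \<and> \<not> (f \<in> ps_ideal (p i) \<and> g \<in> ps_ideal (p i))" for i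
  define P where "P s \<longleftrightarrow> fst s \<in> carrier (ps_ring R)" for s :: "(nat \<Rightarrow> 'a) \<times> nat"
  \<comment> \<open>A state is a multiplier with a bound below which its coefficients are frozen.
    The coefficient of \<open>?h a\<close> at \<open>m\<close> involves only the coefficients of
    \<open>a\<close> up to \<open>m\<close>, so a witness \<open>m\<close> below the new bound
    survives all later changes.\<close>
  define Q where "Q i s s' \<longleftrightarrow> snd s < snd s' \<and> (\<forall>m < snd s. fst s' m = fst s m) \<and>
      (bad i \<longrightarrow> (\<exists>m < snd s'. ?h (fst s') m \<notin> p i))" for i and s s' :: "(nat \<Rightarrow> 'a) \<times> nat"
  have step: "\<exists>s'. P s' \<and> Q i s s'" if "P s" for s i
  proof -
    obtain a N where s: "s = (a, N)" by (cases s)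
    have a: "a \<in> carrier (ps_ring R)"
      using that by (simp add: s P_def)
    consider "\<not> bad i" | "bad i" "?h a \<notin> ps_ideal (p i)" | "bad i" "?h a \<in> ps_ideal (p i)"
      by blast
    then show ?thesis
    proof cases
      case 1
      then show ?thesis
        using a by (intro exI[of _ "(a, Suc N)"]) (simp add: P_def Q_def s)
    next
      case 2
      then obtain m where "?h a m \<notin> p i"
        by (auto simp: ps_ideal_def)
      then show ?thesis
        using a by (intro exI[of _ "(a, Suc (max m N))"]) (auto simp: P_def Q_def s intro!: exI[of _ m])
    next
      case 3
      then have i: "i \<in> I" by (simp add: bad_def)
      interpret P: ideal "ps_ideal (p i)" "ps_ring R"
        by (rule ideal_ps_ideal[OF p[OF i]])
      \<comment> \<open>Otherwise \<open>f\<close> could be recovered from \<open>?h a\<close>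
        inside the ideal, and \<open>i\<close> would not be bad.\<close>
      have "g \<notin> ps_ideal (p i)"
      proof
        assume gP: "g \<in> ps_ideal (p i)"
        have "f = ?h a \<ominus>\<^bsub>ps_ring R\<^esub> a \<otimes>\<^bsub>ps_ring R\<^esub> g"
          using a f g by algebra
        also have "\<dots> \<in> ps_ideal (p i)"
          using 3 gP a by (intro P.minus_mem P.I_l_closed)
        finally show False
          using gP 3 by (simp add: bad_def)
      qed
      then obtain m where m: "g m \<notin> p i"
        by (auto simp: ps_ideal_def)
      define e where "e n = (if N = n then \<one> else \<zero>)" for n
      have e: "e \<in> carrier (ps_ring R)"
        by (simp add: e_def ps_carrier_iff)
      have gc: "g n \<in> carrier R" for n
        using g by (simp add: ps_carrier_iff)
      have "(e \<otimes>\<^bsub>ps_ring R\<^esub> g) (N + m) = (\<Oplus>j\<in>{..N + m}. if N = j then g (N + m - j) else \<zero>)"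
        unfolding ps_mult_nth using gc by (intro finsum_cong') (auto simp: e_def)
      also have "\<dots> = g (N + m - N)"
        using gc by (intro finsum_singleton) auto
      finally have eg: "(e \<otimes>\<^bsub>ps_ring R\<^esub> g) (N + m) = g m"
        by simp
      let ?a = "a \<oplus>\<^bsub>ps_ring R\<^esub> e"
      have "?h ?a = ?h a \<oplus>\<^bsub>ps_ring R\<^esub> e \<otimes>\<^bsub>ps_ring R\<^esub> g"
        using a e f g by algebra
      then have ha: "?h ?a (N + m) = ?h a (N + m) \<oplus> g m"
        by (simp add: ps_add_nth eg)
      have "?h ?a (N + m) \<notin> p i"
      proof
        assume *: "?h ?a (N + m) \<in> p i"
        interpret p: ideal "p i" R by (rule p[OF i])
        have h: "?h a (N + m) \<in> p i"
          using 3 by (simp add: ps_ideal_def)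
        have "g m = ?h ?a (N + m) \<ominus> ?h a (N + m)"
          unfolding ha using gc p.Icarr[OF h] by (simp add: a_minus_def a_assoc a_comm[of _ "g m"] r_neg)
        also have "\<dots> \<in> p i"
          using * h by (rule p.minus_mem)
        finally show False using m by simp
      qed
      moreover have "?a n = a n" if "n < N" for n
        using that a by (simp add: ps_add_nth e_def ps_carrier_iff)
      ultimately show ?thesis
        using a e by (intro exI[of _ "(?a, Suc (N + m))"]) (auto simp: P_def Q_def s)
    qed
  qed
  have "\<exists>st. \<forall>i. P (st i) \<and> Q i (st i) (st (Suc i))"
    by (rule dependent_nat_choice)
      (use step in \<open>auto simp: P_def intro!: exI[of _ "\<zero>\<^bsub>ps_ring R\<^esub>"]\<close>)
  then obtain st where st: "\<And>i. P (st i)" "\<And>i. Q i (st i) (st (Suc i))"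
    by blast
  have st_ge: "k \<le> snd (st k)" for k
  proof (induction k)
    case (Suc k)
    then show ?case using st(2)[of k] by (simp add: Q_def)
  qed simp
  have stable: "fst (st (k + d)) m = fst (st k) m \<and> m < snd (st (k + d))" if "m < snd (st k)" for k d m
    using that
  proof (induction d)
    case (Suc d)
    then show ?case using st(2)[of "k + d"] by (auto simp: Q_def)
  qed simp
  \<comment> \<open>The limit is taken diagonally: the bound of \<open>st (Suc m)\<close> is at
    least \<open>Suc m\<close>, so coefficient \<open>m\<close> is frozen there.\<close>
  define a where "a m = fst (st (Suc m)) m" for m
  have a_eq: "a m = fst (st k) m" if "m < snd (st k)" for m k
  proof (cases "k \<le> Suc m")
    case True
    then show ?thesis
      using stable[OF that, of "Suc m - k"] by (simp add: a_def)
  next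
    case False
    moreover have "m < snd (st (Suc m))"
      using st_ge[of "Suc m"] by simp
    ultimately show ?thesis
      using stable[of m "Suc m" "k - Suc m"] by (simp add: a_def)
  qed
  have ac: "a \<in> carrier (ps_ring R)"
    using st(1) by (auto simp: a_def P_def ps_carrier_iff)
  show thesis
  proof (rule that[OF ac])
    fix i assume i: "i \<in> I" and h: "?h a \<in> ps_ideal (p i)"
    show "f \<in> ps_ideal (p i) \<and> g \<in> ps_ideal (p i)"
    proof (rule ccontr)
      assume "\<not> ?thesis"
      then have "bad i" using i by (simp add: bad_def)
      then obtain m where m: "m < snd (st (Suc i))" "?h (fst (st (Suc i))) m \<notin> p i"
        using st(2)[of i] by (auto simp: Q_def)
      have "(a \<otimes>\<^bsub>ps_ring R\<^esub> g) m = (fst (st (Suc i)) \<otimes>\<^bsub>ps_ring R\<^esub> g) m"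
        unfolding ps_mult_nth using ac g m(1) st(1)[of "Suc i"]
        by (intro finsum_cong') (auto simp: a_eq[of _ "Suc i"] P_def ps_carrier_iff)
      then have "?h a m = ?h (fst (st (Suc i))) m"
        by (simp add: ps_add_nth)
      with m(2) h show False
        unfolding ps_ideal_def by (metis mem_Collect_eq)
    qed
  qed
qed

text \<open>If \<open>h\<close> serves \<open>F\<close>, the combination of \<open>f\<close> and
  \<open>h\<close> given by \<open>ps_avoid_pair\<close> lies in \<open>ps_ideal (p i)\<close> only
  when both do, and then \<open>F\<close> follows through \<open>h\<close>.\<close>

lemma (in cring) ps_avoid_finite:
  fixes p :: "nat \<Rightarrow> 'a set"
  assumes p: "\<And>i. i \<in> I \<Longrightarrow> ideal (p i) R" and Q: "ideal Q (ps_ring R)"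
    and "finite F" "F \<subseteq> Q"
  shows "\<exists>h\<in>Q. \<forall>i\<in>I. h \<in> ps_ideal (p i) \<longrightarrow> F \<subseteq> ps_ideal (p i)"
  using assms(3,4)
proof (induction F)
  case empty
  interpret Q: ideal Q "ps_ring R" by (rule Q)
  show ?case by (intro bexI[of _ "\<zero>\<^bsub>ps_ring R\<^esub>"]) auto
next
  case (insert f F)
  interpret Q: ideal Q "ps_ring R" by (rule Q)
  obtain h where h: "h \<in> Q" "\<And>i. i \<in> I \<Longrightarrow> h \<in> ps_ideal (p i) \<Longrightarrow> F \<subseteq> ps_ideal (p i)"
    using insert by auto
  obtain a where a: "a \<in> carrier (ps_ring R)"
    "\<And>i. i \<in> I \<Longrightarrow> f \<oplus>\<^bsub>ps_ring R\<^esub> a \<otimes>\<^bsub>ps_ring R\<^esub> h \<in> ps_ideal (p i) \<Longrightarrow>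
       f \<in> ps_ideal (p i) \<and> h \<in> ps_ideal (p i)"
    using ps_avoid_pair[of I p f h] p h(1) insert.prems Q.Icarr by blast
  show ?case
    using a h insert.prems
    by (intro bexI[of _ "f \<oplus>\<^bsub>ps_ring R\<^esub> a \<otimes>\<^bsub>ps_ring R\<^esub> h"]) (auto intro: Q.I_l_closed)
qed

text \<open>Finitely many coefficients of members of \<open>Q\<close> generate the ideal of all such
  coefficients. An \<open>h\<close> in \<open>Q\<close> that detects the series carrying these
  generators lies in some \<open>ps_ideal (p i)\<close>; then \<open>p i\<close> contains the
  generators and so every coefficient of \<open>Q\<close>.\<close>

lemma (in noetherian_cring) ps_countable_avoidance:
  fixes p :: "nat \<Rightarrow> 'a set"
  assumes p: "\<And>i. i \<in> I \<Longrightarrow> ideal (p i) R" and Q: "ideal Q (ps_ring R)"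
    and sub: "Q \<subseteq> (\<Union>i\<in>I. ps_ideal (p i))"
  obtains i where "i \<in> I" "Q \<subseteq> ps_ideal (p i)"
proof -
  interpret Q: ideal Q "ps_ring R" by (rule Q)
  define C where "C = (\<lambda>(f, n). f n) ` (Q \<times> (UNIV :: nat set))"
  have "C \<subseteq> carrier R"
    using Q.Icarr by (auto simp: C_def ps_carrier_iff)
  then obtain G where G: "finite G" "G \<subseteq> C" "Idl G = Idl C"
    by (rule Idl_finite_subset)
  \<comment> \<open>\<open>E\<close> records for each generator a series in \<open>Q\<close> and the
    index at which the generator occurs.\<close>
  then obtain E where E: "finite E" "E \<subseteq> Q \<times> UNIV" "G = (\<lambda>(f, n). f n) ` E"
    unfolding C_def by (meson finite_subset_image)
  have "finite (fst ` E)" "fst ` E \<subseteq> Q"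
    using E by auto
  then obtain h where h: "h \<in> Q" "\<forall>i\<in>I. h \<in> ps_ideal (p i) \<longrightarrow> fst ` E \<subseteq> ps_ideal (p i)"
    using ps_avoid_finite[where I = I and p = p, OF p Q] by blast
  then obtain i where i: "i \<in> I" "fst ` E \<subseteq> ps_ideal (p i)"
    using sub by blast
  then have "G \<subseteq> p i"
    unfolding E(3) ps_ideal_def by force
  then have "Idl C \<subseteq> p i"
    using p[OF i(1)] unfolding G(3)[symmetric] by (rule genideal_minimal[rotated])
  then have "C \<subseteq> p i"
    using genideal_self[OF \<open>C \<subseteq> carrier R\<close>] by blast
  then have "Q \<subseteq> ps_ideal (p i)"
    by (auto simp: C_def ps_ideal_def)
  with i(1) that show thesis by blast
qed


section \<open>Flatness\<close>

abbreviation frag_map :: "('a \<Rightarrow> 'b) \<Rightarrow> ('a \<Rightarrow>\<^sub>0 int) \<Rightarrow> ('b \<Rightarrow>\<^sub>0 int)" where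
  "frag_map h \<equiv> frag_extend (\<lambda>z. frag_of (h z))"

lemma frag_map_comp: "frag_map g (frag_map h c) = frag_map (\<lambda>z. g (h z)) c"
  using frag_extend_compose[of "\<lambda>z. frag_of (g z)" h c] by (simp add: o_def)

lemma keys_frag_map: "Poly_Mapping.keys (frag_map h c) \<subseteq> h ` Poly_Mapping.keys c"
  using keys_frag_extend[of "\<lambda>z. frag_of (h z)" c] by auto

abbreviation tensor_frags ::
    "('a, 'm, 'x) module_scheme \<Rightarrow> ('a, 'n, 'y) module_scheme \<Rightarrow> ('m \<times> 'n \<Rightarrow>\<^sub>0 int) set" where
  "tensor_frags M N \<equiv> {c. Poly_Mapping.keys c \<subseteq> carrier M \<times> carrier N}"

lemma tensor_frags_diff: "c \<in> tensor_frags M N \<Longrightarrow> d \<in> tensor_frags M N \<Longrightarrow> c - d \<in> tensor_frags M N"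
  using keys_diff[of c d] by auto

lemma subgroup_tensor_subgroup:
  assumes "module R M" "module R N"
  shows "subgroup (tensor_subgroup R M N) (free_Abelian_group (carrier M \<times> carrier N))"
  unfolding tensor_subgroup_def
  by (rule group.generate_is_subgroup[OF group_free_Abelian_group tensor_relations_subset[OF assms]])

lemma tensor_subgroup_frags:
  assumes "module R M" "module R N"
  shows "tensor_subgroup R M N \<subseteq> tensor_frags M N"
  using subgroup.subset[OF subgroup_tensor_subgroup[OF assms]]
  by (simp add: free_Abelian_group_def)

lemma tensor_subgroup_zero: "0 \<in> tensor_subgroup R M N"
  using generate.one[of "free_Abelian_group (carrier M \<times> carrier N)" "tensor_relations R M N"]
  by (simp add: tensor_subgroup_def)

lemma tensor_subgroup_add:
  "c \<in> tensor_subgroup R M N \<Longrightarrow> d \<in> tensor_subgroup R M N \<Longrightarrow> c + d \<in> tensor_subgroup R M N"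
  using generate.eng[of c "free_Abelian_group (carrier M \<times> carrier N)" "tensor_relations R M N" d]
  by (simp add: tensor_subgroup_def)

lemma tensor_subgroup_diff:
  assumes "module R M" "module R N"
    and c: "c \<in> tensor_subgroup R M N" and d: "d \<in> tensor_subgroup R M N"
  shows "c - d \<in> tensor_subgroup R M N"
proof -
  have "Poly_Mapping.keys d \<subseteq> carrier M \<times> carrier N"
    using d tensor_subgroup_frags[OF assms(1,2)] by blast
  then have "- d \<in> tensor_subgroup R M N"
    using subgroup.m_inv_closed[OF subgroup_tensor_subgroup[OF assms(1,2)] d] by simp
  then show ?thesis
    using tensor_subgroup_add[OF c, of "- d"] by simp
qed

lemma tensor_subgroup_sum:
  assumes "\<And>i. i \<in> K \<Longrightarrow> c i \<in> tensor_subgroup R M N"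
  shows "sum c K \<in> tensor_subgroup R M N"
  using assms by (induction K rule: infinite_finite_induct)
    (auto intro: tensor_subgroup_zero tensor_subgroup_add)

lemma tensor_relations_subgroup: "tensor_relations R M N \<subseteq> tensor_subgroup R M N"
  unfolding tensor_subgroup_def by (auto intro: generate.incl)

lemma tensor_relation_left:
  "x \<in> carrier M \<Longrightarrow> x' \<in> carrier M \<Longrightarrow> y \<in> carrier N \<Longrightarrow>
    frag_of (x \<oplus>\<^bsub>M\<^esub> x', y) - frag_of (x, y) - frag_of (x', y) \<in> tensor_relations R M N"
  unfolding tensor_relations_def by blast

lemma tensor_relation_right:
  "x \<in> carrier M \<Longrightarrow> y \<in> carrier N \<Longrightarrow> y' \<in> carrier N \<Longrightarrow>
    frag_of (x, y \<oplus>\<^bsub>N\<^esub> y') - frag_of (x, y) - frag_of (x, y') \<in> tensor_relations R M N"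
  unfolding tensor_relations_def by blast

lemma tensor_relation_smult:
  "r \<in> carrier R \<Longrightarrow> x \<in> carrier M \<Longrightarrow> y \<in> carrier N \<Longrightarrow>
    frag_of (r \<odot>\<^bsub>M\<^esub> x, y) - frag_of (x, r \<odot>\<^bsub>N\<^esub> y) \<in> tensor_relations R M N"
  unfolding tensor_relations_def by blast

lemma tensor_relations_cases:
  assumes "c \<in> tensor_relations R M N"
  obtains
    (left) x x' y where "x \<in> carrier M" "x' \<in> carrier M" "y \<in> carrier N"
      "c = frag_of (x \<oplus>\<^bsub>M\<^esub> x', y) - frag_of (x, y) - frag_of (x', y)"
  | (right) x y y' where "x \<in> carrier M" "y \<in> carrier N" "y' \<in> carrier N"
      "c = frag_of (x, y \<oplus>\<^bsub>N\<^esub> y') - frag_of (x, y) - frag_of (x, y')"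
  | (smult) r x y where "r \<in> carrier R" "x \<in> carrier M" "y \<in> carrier N"
      "c = frag_of (r \<odot>\<^bsub>M\<^esub> x, y) - frag_of (x, r \<odot>\<^bsub>N\<^esub> y)"
  using assms unfolding tensor_relations_def by blast

text \<open>Closure under differences suffices, as -d = 0 - d and c + d = c - (0 - d). This is the
  induction principle for transporting relations along maps of formal sums.\<close>

lemma tensor_subgroup_least:
  assumes MN: "module R M" "module R N"
    and rel: "tensor_relations R M N \<subseteq> K" and zero: "0 \<in> K"
    and diff: "\<And>c d. c \<in> K \<Longrightarrow> d \<in> K \<Longrightarrow> c - d \<in> K"
  shows "tensor_subgroup R M N \<subseteq> K"
proof
  fix c assume "c \<in> tensor_subgroup R M N"
  then show "c \<in> K"
    unfolding tensor_subgroup_def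
  proof (induction c rule: generate.induct)
    case (inv c)
    then have "Poly_Mapping.keys c \<subseteq> carrier M \<times> carrier N"
      using tensor_relations_subset[OF MN] by (auto simp: free_Abelian_group_def)
    then show ?case
      using diff[OF zero] rel inv by auto
  next
    case (eng c d)
    then have "c - (0 - d) \<in> K"
      by (intro diff zero)
    then show ?case by simp
  qed (use rel zero in auto)
qed

text \<open>This makes \<open>id \<otimes> g\<close> well defined: linearity of \<open>g\<close>
  carries each kind of relation to a relation of the same kind.\<close>

lemma tensor_subgroup_map_right:
  assumes M: "module R M" and N: "module R N" and N': "module R N'" and g: "g \<in> module_hom R N N'"
    and c: "c \<in> tensor_subgroup R M N"
  shows "frag_map (\<lambda>(x, y). (x, g y)) c \<in> tensor_subgroup R M N'"
proof -
  interpret N: module R N by fact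
  let ?h = "frag_map (\<lambda>(x, y). (x, g y))"
  have gN: "g y \<in> carrier N'" if "y \<in> carrier N" for y
    using g that by (auto simp: module_hom_def)
  have "tensor_subgroup R M N \<subseteq> {c. ?h c \<in> tensor_subgroup R M N'}"
  proof (rule tensor_subgroup_least[OF M N])
    have "?h c \<in> tensor_relations R M N'" if "c \<in> tensor_relations R M N" for c
      using that
    proof (cases rule: tensor_relations_cases)
      case (left x x' y)
      then show ?thesis
        by (auto simp: frag_extend_diff intro!: tensor_relation_left gN)
    next
      case (right x y y')
      moreover from this have "g (y \<oplus>\<^bsub>N\<^esub> y') = g y \<oplus>\<^bsub>N'\<^esub> g y'"
        using g by (simp add: module_hom_def)
      ultimately show ?thesis
        by (auto simp: frag_extend_diff intro!: tensor_relation_right gN)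
    next
      case (smult r x y)
      moreover from this have "g (r \<odot>\<^bsub>N\<^esub> y) = r \<odot>\<^bsub>N'\<^esub> g y"
        using g by (simp add: module_hom_def)
      ultimately show ?thesis
        by (auto simp: frag_extend_diff intro!: tensor_relation_smult gN)
    qed
    then show "tensor_relations R M N \<subseteq> {c. ?h c \<in> tensor_subgroup R M N'}"
      using tensor_relations_subgroup by blast
  qed (auto simp: frag_extend_diff intro: tensor_subgroup_zero tensor_subgroup_diff[OF M N'])
  with c show ?thesis by blast
qed

lemma tensor_coset_eq_iff:
  assumes MN: "module R M" "module R N"
  shows "tensor_subgroup R M N #>\<^bsub>free_Abelian_group (carrier M \<times> carrier N)\<^esub> c =
      tensor_subgroup R M N #>\<^bsub>free_Abelian_group (carrier M \<times> carrier N)\<^esub> d \<longleftrightarrow>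
    c - d \<in> tensor_subgroup R M N" (is "?C c = ?C d \<longleftrightarrow> _")
proof -
  have mem: "z \<in> ?C c \<longleftrightarrow> z - c \<in> tensor_subgroup R M N" for z c
    by (auto simp: r_coset_def) (metis diff_add_cancel)
  show ?thesis
  proof
    assume "?C c = ?C d"
    moreover have "c \<in> ?C c"
      by (simp add: mem tensor_subgroup_zero)
    ultimately show "c - d \<in> tensor_subgroup R M N"
      by (simp add: mem)
  next
    assume cd: "c - d \<in> tensor_subgroup R M N"
    have "z - c \<in> tensor_subgroup R M N \<longleftrightarrow> z - d \<in> tensor_subgroup R M N" for z
      using tensor_subgroup_add[OF _ cd, of "z - c"] tensor_subgroup_diff[OF MN _ cd, of "z - d"]
      by auto
    then show "?C c = ?C d"
      using mem by blast
  qed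
qed

text \<open>Injectivity amounts to a trivial kernel, as formal sums can be subtracted. With the
  criterion phrased on formal sums, later arguments need no cosets.\<close>

lemma flat_module_iff:
  fixes R :: "('a, 'r) ring_scheme" and N :: "('a, 'n, 'y) module_scheme"
  shows "flat_module TYPE('m) TYPE('k) R N \<longleftrightarrow> module R N \<and>
    (\<forall>(M :: ('a, 'm) module) (M' :: ('a, 'k) module) f c.
      module R M \<longrightarrow> module R M' \<longrightarrow> f \<in> module_hom R M M' \<longrightarrow> inj_on f (carrier M) \<longrightarrow>
      c \<in> tensor_frags M N \<longrightarrow>
      frag_map (\<lambda>(x, y). (f x, y)) c \<in> tensor_subgroup R M' N \<longrightarrow> c \<in> tensor_subgroup R M N)"
proof -
  have "inj_on (tensor_map_left R M M' N f) (carrier (tensor R M N)) \<longleftrightarrow>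
      (\<forall>c\<in>tensor_frags M N. frag_map (\<lambda>(x, y). (f x, y)) c \<in> tensor_subgroup R M' N \<longrightarrow>
        c \<in> tensor_subgroup R M N)" (is "?inj \<longleftrightarrow> ?ker")
    if M: "module R M" and M': "module R M'" and N: "module R N" and f: "f \<in> module_hom R M M'"
    for M :: "('a, 'm) module" and M' :: "('a, 'k) module" and f
  proof -
    let ?C = "\<lambda>c. tensor_subgroup R M N #>\<^bsub>free_Abelian_group (carrier M \<times> carrier N)\<^esub> c"
    let ?C' = "\<lambda>c. tensor_subgroup R M' N #>\<^bsub>free_Abelian_group (carrier M' \<times> carrier N)\<^esub> c"
    let ?f = "frag_map (\<lambda>(x, y). (f x, y))"
    have f_eq: "frag_extend (\<lambda>(x, y). frag_of (f x, y)) = ?f"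
      by (rule arg_cong[of _ _ frag_extend]) auto
    have map: "tensor_map_left R M M' N f (?C c) = ?C' (?f c)" if "c \<in> tensor_frags M N" for c
      using tensor_map_left_coset[OF M M' N f] that unfolding f_eq by blast
    have carr: "carrier (tensor R M N) = ?C ` tensor_frags M N"
      by (auto simp: tensor_def FactGroup_def RCOSETS_def)
    have "?inj \<longleftrightarrow> (\<forall>c\<in>tensor_frags M N. \<forall>d\<in>tensor_frags M N.
        ?C' (?f c) = ?C' (?f d) \<longrightarrow> ?C c = ?C d)"
      unfolding carr inj_on_def by (auto simp: map)
    also have "\<dots> \<longleftrightarrow> (\<forall>c\<in>tensor_frags M N. \<forall>d\<in>tensor_frags M N.
        ?f (c - d) \<in> tensor_subgroup R M' N \<longrightarrow> c - d \<in> tensor_subgroup R M N)"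
      by (simp add: tensor_coset_eq_iff[OF M N] tensor_coset_eq_iff[OF M' N] frag_extend_diff)
    also have "\<dots> \<longleftrightarrow> ?ker"
    proof
      assume *: "\<forall>c\<in>tensor_frags M N. \<forall>d\<in>tensor_frags M N.
        ?f (c - d) \<in> tensor_subgroup R M' N \<longrightarrow> c - d \<in> tensor_subgroup R M N"
      show ?ker
        using *[rule_format, of _ 0] by simp
    qed (use tensor_frags_diff in blast)
    finally show ?thesis .
  qed
  then show ?thesis
    unfolding flat_module_def by (auto 6 0)
qed

lemma module_scalar_restriction:
  assumes R: "cring R" and A: "cring A" and \<phi>: "\<phi> \<in> ring_hom R A"
  shows "module R (scalar_restriction \<phi> A)"
proof -
  interpret R: cring R by fact
  interpret A: cring A by fact
  note [simp] = ring_hom_closed[OF \<phi>] ring_hom_add[OF \<phi>] ring_hom_mult[OF \<phi>] ring_hom_one[OF \<phi>]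
  show ?thesis
  proof (rule moduleI)
    show "abelian_group (scalar_restriction \<phi> A)"
      by (rule abelian_groupI)
        (auto simp: scalar_restriction_def A.a_ac intro: A.l_neg bexI[OF _ A.a_inv_closed])
  qed (auto simp: scalar_restriction_def A.l_distr A.r_distr A.m_assoc R)
qed

text \<open>Since 0 + 0 = 0, the additivity relation for two zeros collapses to the negative of the
  symbol in question.\<close>

lemma tensor_subgroup_zero_left:
  assumes M: "module R M" and N: "module R N" and y: "y \<in> carrier N"
  shows "frag_of (\<zero>\<^bsub>M\<^esub>, y) \<in> tensor_subgroup R M N"
proof -
  interpret M: module R M by fact
  have "frag_of (\<zero>\<^bsub>M\<^esub>, y) - frag_of (\<zero>\<^bsub>M\<^esub>, y) - frag_of (\<zero>\<^bsub>M\<^esub>, y) \<in> tensor_subgroup R M N"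
    using tensor_relation_left[of "\<zero>\<^bsub>M\<^esub>" M "\<zero>\<^bsub>M\<^esub>" y N R] y tensor_relations_subgroup[of R M N]
    by auto
  from tensor_subgroup_diff[OF M N tensor_subgroup_zero this] show ?thesis
    by simp
qed

lemma tensor_subgroup_zero_right:
  assumes M: "module R M" and N: "module R N" and x: "x \<in> carrier M"
  shows "frag_of (x, \<zero>\<^bsub>N\<^esub>) \<in> tensor_subgroup R M N"
proof -
  interpret N: module R N by fact
  have "frag_of (x, \<zero>\<^bsub>N\<^esub>) - frag_of (x, \<zero>\<^bsub>N\<^esub>) - frag_of (x, \<zero>\<^bsub>N\<^esub>) \<in> tensor_subgroup R M N"
    using tensor_relation_right[of x M "\<zero>\<^bsub>N\<^esub>" N "\<zero>\<^bsub>N\<^esub>" R] x tensor_relations_subgroup[of R M N]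
    by auto
  from tensor_subgroup_diff[OF M N tensor_subgroup_zero this] show ?thesis
    by simp
qed

lemma tensor_subgroup_diff_left:
  assumes M: "module R M" and N: "module R N" and x: "x \<in> carrier M" "x' \<in> carrier M" "y \<in> carrier N"
  shows "frag_of (x \<ominus>\<^bsub>M\<^esub> x', y) - (frag_of (x, y) - frag_of (x', y)) \<in> tensor_subgroup R M N"
proof -
  interpret M: module R M by fact
  have "x \<ominus>\<^bsub>M\<^esub> x' \<oplus>\<^bsub>M\<^esub> x' = x"
    using x by (simp add: a_minus_def M.a_assoc M.l_neg)
  then have "frag_of (x, y) - frag_of (x \<ominus>\<^bsub>M\<^esub> x', y) - frag_of (x', y) \<in> tensor_subgroup R M N"
    using tensor_relation_left[of "x \<ominus>\<^bsub>M\<^esub> x'" M x' y N R] x tensor_relations_subgroup[of R M N]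
    by auto
  from tensor_subgroup_diff[OF M N tensor_subgroup_zero this] show ?thesis
    by (simp add: algebra_simps)
qed

lemma tensor_subgroup_finsum_right:
  assumes M: "module R M" and N: "module R N" and x: "x \<in> carrier M"
    and "finite K" "y \<in> K \<rightarrow> carrier N"
  shows "frag_of (x, \<Oplus>\<^bsub>N\<^esub>k\<in>K. y k) - (\<Sum>k\<in>K. frag_of (x, y k)) \<in> tensor_subgroup R M N"
  using assms(4,5)
proof (induction K)
  case empty
  interpret N: module R N by fact
  show ?case
    using tensor_subgroup_zero_right[OF M N x] by simp
next
  case (insert k K)
  interpret N: module R N by fact
  have "frag_of (x, y k \<oplus>\<^bsub>N\<^esub> (\<Oplus>\<^bsub>N\<^esub>k\<in>K. y k)) - frag_of (x, y k) - frag_of (x, \<Oplus>\<^bsub>N\<^esub>k\<in>K. y k)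
      \<in> tensor_subgroup R M N"
    using insert.prems x tensor_relations_subgroup[of R M N]
    by (intro subsetD[OF tensor_relations_subgroup] tensor_relation_right N.finsum_closed) auto
  moreover have "frag_of (x, \<Oplus>\<^bsub>N\<^esub>k\<in>K. y k) - (\<Sum>k\<in>K. frag_of (x, y k)) \<in> tensor_subgroup R M N"
    using insert by auto
  ultimately have "frag_of (x, y k \<oplus>\<^bsub>N\<^esub> (\<Oplus>\<^bsub>N\<^esub>k\<in>K. y k)) - frag_of (x, y k)
      - frag_of (x, \<Oplus>\<^bsub>N\<^esub>k\<in>K. y k) + (frag_of (x, \<Oplus>\<^bsub>N\<^esub>k\<in>K. y k) - (\<Sum>k\<in>K. frag_of (x, y k)))
      \<in> tensor_subgroup R M N"
    by (rule tensor_subgroup_add)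
  moreover have "(\<Oplus>\<^bsub>N\<^esub>k\<in>insert k K. y k) = y k \<oplus>\<^bsub>N\<^esub> (\<Oplus>\<^bsub>N\<^esub>k\<in>K. y k)"
    using insert by (intro N.finsum_insert) auto
  ultimately show ?case
    using insert(1,2) by (simp add: algebra_simps)
qed

section \<open>Flatness from finite dual bases\<close>

lemma module_hom_zero:
  assumes "module R M" "module R M'" "f \<in> module_hom R M M'"
  shows "f \<zero>\<^bsub>M\<^esub> = \<zero>\<^bsub>M'\<^esub>"
proof -
  interpret M: module R M by fact
  interpret M': module R M' by fact
  have c: "f \<zero>\<^bsub>M\<^esub> \<in> carrier M'"
    using assms(3) by (auto simp: module_hom_def)
  have "f (\<zero>\<^bsub>M\<^esub> \<oplus>\<^bsub>M\<^esub> \<zero>\<^bsub>M\<^esub>) = f \<zero>\<^bsub>M\<^esub> \<oplus>\<^bsub>M'\<^esub> f \<zero>\<^bsub>M\<^esub>"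
    using assms(3) M.zero_closed unfolding module_hom_def by blast
  with c show ?thesis
    by (metis M.l_zero M.zero_closed M'.add.r_cancel_one')
qed

lemma module_hom_diff:
  assumes "module R M" "module R M'" "f \<in> module_hom R M M'" and x: "x \<in> carrier M" "y \<in> carrier M"
  shows "f (x \<ominus>\<^bsub>M\<^esub> y) = f x \<ominus>\<^bsub>M'\<^esub> f y"
proof -
  interpret M: module R M by fact
  interpret M': module R M' by fact
  have c: "f z \<in> carrier M'" if "z \<in> carrier M" for z
    using that assms(3) by (auto simp: module_hom_def)
  have "x \<ominus>\<^bsub>M\<^esub> y \<oplus>\<^bsub>M\<^esub> y = x"
    using x by (simp add: a_minus_def M.a_assoc M.l_neg)
  moreover have "f (x \<ominus>\<^bsub>M\<^esub> y \<oplus>\<^bsub>M\<^esub> y) = f (x \<ominus>\<^bsub>M\<^esub> y) \<oplus>\<^bsub>M'\<^esub> f y"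
    using assms(3) x M.minus_closed unfolding module_hom_def by blast
  ultimately have "f x = f (x \<ominus>\<^bsub>M\<^esub> y) \<oplus>\<^bsub>M'\<^esub> f y"
    by simp
  then show ?thesis
    using x c by (simp add: a_minus_def M'.a_assoc M'.r_neg)
qed

text \<open>The map \<open>M \<otimes> N \<rightarrow> M\<close>, \<open>x \<otimes> y \<mapsto> \<epsilon>(y) x\<close>, on formal sums.\<close>

lemma contraction_ex:
  assumes R: "cring R" and M: "module R M" and N: "module R N"
    and \<epsilon>: "\<epsilon> \<in> module_hom R N (scalar_restriction id R)"
  shows "\<exists>h. h 0 = \<zero>\<^bsub>M\<^esub> \<and> (\<forall>c\<in>tensor_frags M N. h c \<in> carrier M) \<and>
    (\<forall>c\<in>tensor_frags M N. \<forall>d\<in>tensor_frags M N. h (c - d) = h c \<ominus>\<^bsub>M\<^esub> h d) \<and>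
    (\<forall>x\<in>carrier M. \<forall>y\<in>carrier N. h (frag_of (x, y)) = \<epsilon> y \<odot>\<^bsub>M\<^esub> x) \<and>
    (\<forall>c\<in>tensor_subgroup R M N. h c = \<zero>\<^bsub>M\<^esub>)"
proof -
  interpret R: cring R by fact
  interpret M: module R M by fact
  interpret N: module R N by fact
  let ?F = "free_Abelian_group (carrier M \<times> carrier N)"
  have \<epsilon>_closed: "\<epsilon> y \<in> carrier R" if "y \<in> carrier N" for y
    using \<epsilon> that by (auto simp: module_hom_def scalar_restriction_def)
  have \<epsilon>_add: "\<epsilon> (y \<oplus>\<^bsub>N\<^esub> y') = \<epsilon> y \<oplus>\<^bsub>R\<^esub> \<epsilon> y'" if "y \<in> carrier N" "y' \<in> carrier N" for y y'
    using \<epsilon> that by (auto simp: module_hom_def scalar_restriction_def)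
  have \<epsilon>_smult: "\<epsilon> (r \<odot>\<^bsub>N\<^esub> y) = r \<otimes>\<^bsub>R\<^esub> \<epsilon> y" if "r \<in> carrier R" "y \<in> carrier N" for r y
    using \<epsilon> that by (auto simp: module_hom_def scalar_restriction_def)
  have "(\<lambda>(x, y). \<epsilon> y \<odot>\<^bsub>M\<^esub> x) ` (carrier M \<times> carrier N) \<subseteq> carrier (add_monoid M)"
    using \<epsilon>_closed by auto
  then obtain h where h: "h \<in> hom ?F (add_monoid M)"
    and h_of: "\<And>z. z \<in> carrier M \<times> carrier N \<Longrightarrow> h (frag_of z) = (\<lambda>(x, y). \<epsilon> y \<odot>\<^bsub>M\<^esub> x) z"
    using comm_group.free_Abelian_group_universal[OF M.a_comm_group] by blast
  interpret h: group_hom ?F "add_monoid M" h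
    using h by (intro group_hom.intro group_hom_axioms.intro group_free_Abelian_group M.a_group) auto
  have h0: "h 0 = \<zero>\<^bsub>M\<^esub>"
    using h.hom_one by simp
  have hc: "h c \<in> carrier M" if "c \<in> tensor_frags M N" for c
    using h.hom_closed[of c] that by simp
  have h_diff: "h (c - d) = h c \<ominus>\<^bsub>M\<^esub> h d" if "c \<in> tensor_frags M N" "d \<in> tensor_frags M N" for c d
    using h.hom_mult[of c "- d"] h.hom_inv[of d] that by (simp add: a_minus_def a_inv_def)
  have h_of': "h (frag_of (x, y)) = \<epsilon> y \<odot>\<^bsub>M\<^esub> x" if "x \<in> carrier M" "y \<in> carrier N" for x y
    using h_of[of "(x, y)"] that by simp
  have "tensor_subgroup R M N \<subseteq> {c \<in> tensor_frags M N. h c = \<zero>\<^bsub>M\<^esub>}"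
  proof (rule tensor_subgroup_least[OF M N])
    have "h c = \<zero>\<^bsub>M\<^esub>" if "c \<in> tensor_relations R M N" for c
      using that
    proof (cases rule: tensor_relations_cases)
      case (left x x' y)
      then show ?thesis
        using \<epsilon>_closed[of y] tensor_frags_diff[of "frag_of (x \<oplus>\<^bsub>M\<^esub> x', y)" M N "frag_of (x, y)"]
        by (simp add: h_diff h_of' M.smult_r_distr a_minus_def M.a_ac M.r_neg M.r_neg1 M.minus_add)
    next
      case (right x y y')
      then show ?thesis
        using \<epsilon>_closed[of y] \<epsilon>_closed[of y'] tensor_frags_diff[of "frag_of (x, y \<oplus>\<^bsub>N\<^esub> y')" M N "frag_of (x, y)"]
        by (simp add: h_diff h_of' \<epsilon>_add M.smult_l_distr a_minus_def M.a_ac M.r_neg M.r_neg1)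
    next
      case (smult r x y)
      then show ?thesis
        using \<epsilon>_closed[of y]
        by (simp add: h_diff h_of' \<epsilon>_smult M.smult_assoc1[symmetric] R.m_comm a_minus_def M.r_neg)
    qed
    then show "tensor_relations R M N \<subseteq> {c \<in> tensor_frags M N. h c = \<zero>\<^bsub>M\<^esub>}"
      using tensor_relations_subset[OF M N] by (auto simp: free_Abelian_group_def)
    show "c - d \<in> {c \<in> tensor_frags M N. h c = \<zero>\<^bsub>M\<^esub>}"
      if "c \<in> {c \<in> tensor_frags M N. h c = \<zero>\<^bsub>M\<^esub>}" "d \<in> {c \<in> tensor_frags M N. h c = \<zero>\<^bsub>M\<^esub>}" for c d
      using that tensor_frags_diff[of c M N d] h_diff[of c d] by (simp add: a_minus_def)
  qed (simp add: h0)
  then show ?thesis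
    using h0 hc h_diff h_of' by (intro exI[of _ h]) blast
qed

text \<open>\<open>dual\<close> provides a dual basis for every finite subset \<open>Y\<close>. If
  \<open>h k\<close> is contraction along \<open>\<epsilon> k\<close>, a tensor \<open>c\<close>
  with right entries in \<open>Y\<close> equals the sum of the tensors of \<open>h k c\<close> with
  \<open>z k\<close>. Contractions commute with \<open>f\<close>, so if \<open>c\<close> dies in the
  larger tensor product, injectivity of \<open>f\<close> forces every \<open>h k c\<close> to be
  zero.\<close>

lemma flat_module_if_locally_projective:
  fixes R :: "('a, 'r) ring_scheme" and N :: "('a, 'n, 'y) module_scheme"
  assumes R: "cring R" and N: "module R N"
    and dual: "\<And>Y. finite Y \<Longrightarrow> Y \<subseteq> carrier N \<Longrightarrow>
      \<exists>(K :: nat set) \<epsilon> z. finite K \<and> (\<forall>k. \<epsilon> k \<in> module_hom R N (scalar_restriction id R)) \<and>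
        z \<in> K \<rightarrow> carrier N \<and> (\<forall>y\<in>Y. y = (\<Oplus>\<^bsub>N\<^esub>k\<in>K. \<epsilon> k y \<odot>\<^bsub>N\<^esub> z k))"
  shows "flat_module TYPE('m) TYPE('k) R N"
  unfolding flat_module_iff
proof (intro conjI allI impI N)
  fix M :: "('a, 'm) module" and M' :: "('a, 'k) module" and f c
  assume M: "module R M" and M': "module R M'" and f: "f \<in> module_hom R M M'"
    and inj: "inj_on f (carrier M)" and c: "c \<in> tensor_frags M N"
    and fc: "frag_map (\<lambda>(x, y). (f x, y)) c \<in> tensor_subgroup R M' N"
  interpret M: module R M by fact
  interpret N: module R N by fact
  let ?f = "frag_map (\<lambda>(x, y). (f x, y))"
  define Y where "Y = snd ` Poly_Mapping.keys c"
  have Y: "finite Y" "Y \<subseteq> carrier N"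
    using c by (auto simp: Y_def)
  obtain K :: "nat set" and \<epsilon> z where K: "finite K"
    and \<epsilon>: "\<And>k. \<epsilon> k \<in> module_hom R N (scalar_restriction id R)"
    and z: "z \<in> K \<rightarrow> carrier N" and decomp: "\<forall>y\<in>Y. y = (\<Oplus>\<^bsub>N\<^esub>k\<in>K. \<epsilon> k y \<odot>\<^bsub>N\<^esub> z k)"
    using dual[OF Y] by (elim exE conjE) blast
  have \<epsilon>_closed: "\<epsilon> k y \<in> carrier R" if "y \<in> carrier N" for k y
    using \<epsilon>[of k] that by (auto simp: module_hom_def scalar_restriction_def)
  obtain h where h: "\<forall>k. h k 0 = \<zero>\<^bsub>M\<^esub> \<and> (\<forall>c\<in>tensor_frags M N. h k c \<in> carrier M) \<and>
    (\<forall>c\<in>tensor_frags M N. \<forall>d\<in>tensor_frags M N. h k (c - d) = h k c \<ominus>\<^bsub>M\<^esub> h k d) \<and>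
    (\<forall>x\<in>carrier M. \<forall>y\<in>carrier N. h k (frag_of (x, y)) = \<epsilon> k y \<odot>\<^bsub>M\<^esub> x) \<and>
    (\<forall>c\<in>tensor_subgroup R M N. h k c = \<zero>\<^bsub>M\<^esub>)"
    by (rule exE[OF choice[OF allI[OF contraction_ex[OF R M N \<epsilon>]]]])
  have h0: "h k 0 = \<zero>\<^bsub>M\<^esub>" for k
    using h by blast
  have hc: "h k c \<in> carrier M" if "c \<in> tensor_frags M N" for k c
    using h that by blast
  have h_diff: "h k (c - d) = h k c \<ominus>\<^bsub>M\<^esub> h k d"
    if "c \<in> tensor_frags M N" "d \<in> tensor_frags M N" for k c d
    using h that by blast
  have h_of: "h k (frag_of (x, y)) = \<epsilon> k y \<odot>\<^bsub>M\<^esub> x" if "x \<in> carrier M" "y \<in> carrier N" for k x y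
    using h that by blast
  have h_zero: "h k c = \<zero>\<^bsub>M\<^esub>" for k
  proof -
    obtain h' where h'0: "h' 0 = \<zero>\<^bsub>M'\<^esub>"
      and h'_diff: "\<And>c d. c \<in> tensor_frags M' N \<Longrightarrow> d \<in> tensor_frags M' N \<Longrightarrow>
        h' (c - d) = h' c \<ominus>\<^bsub>M'\<^esub> h' d"
      and h'_of: "\<And>x y. x \<in> carrier M' \<Longrightarrow> y \<in> carrier N \<Longrightarrow> h' (frag_of (x, y)) = \<epsilon> k y \<odot>\<^bsub>M'\<^esub> x"
      and h'_kill: "\<And>c. c \<in> tensor_subgroup R M' N \<Longrightarrow> h' c = \<zero>\<^bsub>M'\<^esub>"
      using contraction_ex[OF R M' N \<epsilon>[of k]] by blast
    have f_frags: "?f d \<in> tensor_frags M' N" if "d \<in> tensor_frags M N" for d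
      using keys_frag_map[of "\<lambda>(x, y). (f x, y)" d] that f by (force simp: module_hom_def)
    have "f (h k d) = h' (?f d)" if "Poly_Mapping.keys d \<subseteq> carrier M \<times> carrier N" for d
      using that
    proof (induction d rule: free_Abelian_group_induct[consumes 1, case_names zero diff single])
      case zero
      then show ?case by (simp add: h0 h'0 module_hom_zero[OF M M' f])
    next
      case (diff c d)
      then show ?case
        using f_frags[of c] f_frags[of d]
        by (simp add: h_diff h'_diff frag_extend_diff module_hom_diff[OF M M' f] hc)
    next
      case (single a)
      then show ?case
        using f \<epsilon>_closed by (auto simp: h_of h'_of module_hom_def Pi_iff)
    qed
    then have "f (h k c) = f \<zero>\<^bsub>M\<^esub>"
      using c h'_kill[OF fc] by (simp add: module_hom_zero[OF M M' f])
    then show ?thesis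
      using inj hc[OF c] by (simp add: inj_on_def)
  qed
  \<comment> \<open>A symbol with left entry zero is nonzero in the free group and vanishes only
    modulo relations; this sum is added back at the end.\<close>
  have zero_sum: "(\<Sum>k\<in>K. frag_of (\<zero>\<^bsub>M\<^esub>, z k)) \<in> tensor_subgroup R M N"
    using z by (auto intro!: tensor_subgroup_sum tensor_subgroup_zero_left[OF M N])
  \<comment> \<open>Both terms are additive in \<open>d\<close> modulo relations, so generators
    suffice. For the symbol of \<open>(x, y)\<close>, expand \<open>y\<close> by
    \<open>decomp\<close> and move the scalars to the left entry.\<close>
  have "d - (\<Sum>k\<in>K. frag_of (h k d, z k)) \<in> tensor_subgroup R M N"
    if "Poly_Mapping.keys d \<subseteq> carrier M \<times> Y" for d
    using that
  proof (induction d rule: free_Abelian_group_induct[consumes 1, case_names zero diff single])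
    case zero
    show ?case
      using tensor_subgroup_diff[OF M N tensor_subgroup_zero zero_sum] by (simp add: h0)
  next
    case (diff c d)
    then have cd: "c \<in> tensor_frags M N" "d \<in> tensor_frags M N"
      using Y by auto
    have "(\<Sum>k\<in>K. frag_of (h k (c - d), z k) - (frag_of (h k c, z k) - frag_of (h k d, z k)))
        \<in> tensor_subgroup R M N"
      using cd z by (auto simp: h_diff hc intro!: tensor_subgroup_sum tensor_subgroup_diff_left[OF M N])
    from tensor_subgroup_diff[OF M N tensor_subgroup_diff[OF M N diff(3,4)] this] show ?case
      by (simp add: sum_subtractf sum.distrib algebra_simps)
  next
    case (single a)
    then obtain x y where a: "a = (x, y)" "x \<in> carrier M" "y \<in> Y" "y \<in> carrier N"
      using Y by auto
    have "frag_of (x, \<Oplus>\<^bsub>N\<^esub>k\<in>K. \<epsilon> k y \<odot>\<^bsub>N\<^esub> z k) - (\<Sum>k\<in>K. frag_of (x, \<epsilon> k y \<odot>\<^bsub>N\<^esub> z k))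
        \<in> tensor_subgroup R M N"
      using a z \<epsilon>_closed K by (intro tensor_subgroup_finsum_right[OF M N]) auto
    moreover have "(\<Oplus>\<^bsub>N\<^esub>k\<in>K. \<epsilon> k y \<odot>\<^bsub>N\<^esub> z k) = y"
      using decomp a(3) by metis
    ultimately have 1: "frag_of (x, y) - (\<Sum>k\<in>K. frag_of (x, \<epsilon> k y \<odot>\<^bsub>N\<^esub> z k)) \<in> tensor_subgroup R M N"
      by simp
    have 2: "(\<Sum>k\<in>K. frag_of (\<epsilon> k y \<odot>\<^bsub>M\<^esub> x, z k) - frag_of (x, \<epsilon> k y \<odot>\<^bsub>N\<^esub> z k)) \<in> tensor_subgroup R M N"
      using a z \<epsilon>_closed
      by (intro tensor_subgroup_sum subsetD[OF tensor_relations_subgroup] tensor_relation_smult) auto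
    from tensor_subgroup_diff[OF M N 1 2] show ?case
      by (simp add: a h_of sum_subtractf algebra_simps)
  qed
  moreover have "Poly_Mapping.keys c \<subseteq> carrier M \<times> Y"
    using c by (force simp: Y_def)
  ultimately have "c - (\<Sum>k\<in>K. frag_of (h k c, z k)) \<in> tensor_subgroup R M N"
    by blast
  from tensor_subgroup_add[OF this zero_sum] show "c \<in> tensor_subgroup R M N"
    by (simp add: h_zero)
qed

section \<open>Flatness of localizations\<close>

lemma (in cring) module_hom_mult:
  assumes \<phi>: "\<phi> \<in> ring_hom K R" and u: "u \<in> carrier R"
  shows "(\<lambda>y. u \<otimes> y) \<in> module_hom K (scalar_restriction \<phi> R) (scalar_restriction \<phi> R)"
  using u ring_hom_closed[OF \<phi>]
  by (auto simp: module_hom_def scalar_restriction_def r_distr m_lcomm)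

text \<open>Division by a fixed \<open>s\<close> is linear, so it carries tensor relations over
  \<open>R\<close> to tensor relations over the localization.\<close>

lemma (in cring) module_hom_loc_frac:
  assumes S: "submonoid S R" and \<phi>: "\<phi> \<in> ring_hom K R" and s: "s \<in> S"
  shows "(\<lambda>y. loc_frac R S y s) \<in> module_hom K (scalar_restriction \<phi> R)
    (scalar_restriction (loc_map R S \<circ> \<phi>) (localization R S))"
proof -
  note [simp] = submonoid.one_closed[OF S] submonoid.m_closed[OF S]
  have SR: "s \<in> carrier R" "\<phi> r \<in> carrier R" if "r \<in> carrier K" for r
    using s submonoid.subset[OF S] ring_hom_closed[OF \<phi>] that by auto
  have sc: "s \<in> carrier R" using s submonoid.subset[OF S] by auto
  have "loc_frac R S (a \<oplus> b) s = loc_frac R S (a \<otimes> s \<oplus> b \<otimes> s) (s \<otimes> s)"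
    if "a \<in> carrier R" "b \<in> carrier R" for a b
    using that s sc by (intro loc_frac_eqI[OF S]) (auto simp: l_distr m_assoc)
  then show ?thesis
    using s sc SR
    by (auto simp: module_hom_def scalar_restriction_def carrier_localization loc_map_def
        loc_add_frac[OF S] loc_mult_frac[OF S])
qed

abbreviation (in cring) divide_right :: "'a set \<Rightarrow> 'a \<Rightarrow> ('m \<times> 'a \<Rightarrow>\<^sub>0 int) \<Rightarrow> ('m \<times> ('a \<times> 'a) set \<Rightarrow>\<^sub>0 int)" where
  "divide_right S s \<equiv> frag_map (\<lambda>(x, y). (x, loc_frac R S y s))"

abbreviation (in cring) times_right :: "'a \<Rightarrow> ('m \<times> 'a \<Rightarrow>\<^sub>0 int) \<Rightarrow> ('m \<times> 'a \<Rightarrow>\<^sub>0 int)" where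
  "times_right u \<equiv> frag_map (\<lambda>(x, y). (x, u \<otimes> y))"

context cring
begin

lemma keys_times_right:
  assumes "Poly_Mapping.keys d \<subseteq> B \<times> carrier R" "s \<in> carrier R"
  shows "Poly_Mapping.keys (times_right s d) \<subseteq> B \<times> carrier R"
  using keys_frag_map[of "\<lambda>(x, y). (x, s \<otimes> y)" d] assms by fastforce

lemma divide_right_times_right:
  assumes S: "submonoid S R" and "Poly_Mapping.keys d \<subseteq> B \<times> carrier R" "s \<in> S" "t \<in> S"
  shows "divide_right S (s \<otimes> t) (times_right t d) = divide_right S s d"
proof -
  have c: "s \<in> carrier R" "t \<in> carrier R" "s \<otimes> t \<in> S"
    using assms submonoid.subset[OF S] submonoid.m_closed[OF S] by auto
  have "loc_frac R S (t \<otimes> y) (s \<otimes> t) = loc_frac R S y s" if "y \<in> carrier R" for y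
    using that assms c by (intro loc_frac_eqI[OF S]) (auto simp: m_ac)
  then show ?thesis
    unfolding frag_map_comp using assms(2) by (intro frag_extend_eq) auto
qed

text \<open>Zero is meant in the free group: the terms of \<open>e\<close> cancel once symbols with
  equal images are merged. Each equality of two fractions has a witness in \<open>S\<close>, and a
  product \<open>u\<close> of witnesses for the finitely many pairs merges the same symbols already
  over \<open>R\<close>. Thus \<open>times_right u\<close> factors through
  \<open>divide_right S s\<close> on the support of \<open>e\<close>.\<close>

lemma divide_right_eq_zero:
  assumes S: "submonoid S R" and e: "Poly_Mapping.keys e \<subseteq> B \<times> carrier R" and s: "s \<in> S"
    and zero: "divide_right S s e = 0"
  obtains u where "u \<in> S" "times_right u e = 0"
proof -
  note [simp] = submonoid.one_closed[OF S] submonoid.m_closed[OF S]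
  have SR: "u \<in> carrier R" if "u \<in> S" for u
    using that submonoid.subset[OF S] by auto
  let ?h = "\<lambda>(x, y). (x, loc_frac R S y s)"
  have merge: "\<exists>u\<in>S. \<forall>(z, w)\<in>P. ?h z = ?h w \<longrightarrow> u \<otimes> snd z = u \<otimes> snd w"
    if "finite P" "P \<subseteq> (B \<times> carrier R) \<times> (B \<times> carrier R)" for P
    using that
  proof (induction P)
    case empty
    show ?case by (intro bexI[of _ "\<one>"]) auto
  next
    case (insert q P)
    then obtain u where u: "u \<in> S" "\<forall>(z, w)\<in>P. ?h z = ?h w \<longrightarrow> u \<otimes> snd z = u \<otimes> snd w"
      by auto
    obtain x y x' y' where q: "q = ((x, y), (x', y'))"
      by (metis surj_pair)
    have y: "y \<in> carrier R" "y' \<in> carrier R"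
      using insert.prems q by auto
    have "\<exists>v\<in>S. ?h (x, y) = ?h (x', y') \<longrightarrow> v \<otimes> y = v \<otimes> y'"
    proof (cases "?h (x, y) = ?h (x', y')")
      case True
      then obtain v where v: "v \<in> S" "v \<otimes> (y \<otimes> s \<ominus> y' \<otimes> s) = \<zero>"
        using loc_frac_eq_iff[OF S y(1) s y(2) s] by auto
      \<comment> \<open>The common denominator \<open>s\<close> is absorbed into the witness
        \<open>v\<close>.\<close>
      have "(v \<otimes> s) \<otimes> y = v \<otimes> (y \<otimes> s \<ominus> y' \<otimes> s) \<oplus> (v \<otimes> s) \<otimes> y'"
        using y SR[OF v(1)] SR[OF s] by algebra
      then have "(v \<otimes> s) \<otimes> y = (v \<otimes> s) \<otimes> y'"
        using y SR[OF v(1)] SR[OF s] v(2) by simp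
      then show ?thesis
        using v(1) s by (intro bexI[of _ "v \<otimes> s"]) auto
    qed (use submonoid.one_closed[OF S] in blast)
    then obtain v where v: "v \<in> S" "?h (x, y) = ?h (x', y') \<longrightarrow> v \<otimes> y = v \<otimes> y'"
      by blast
    have "(v \<otimes> u) \<otimes> b = (v \<otimes> u) \<otimes> b'"
      if mem: "((a, b), (a', b')) \<in> insert q P" and h: "a = a'" "loc_frac R S b s = loc_frac R S b' s"
      for a b a' b'
    proof -
      have b: "b \<in> carrier R" "b' \<in> carrier R"
        using insert.prems mem by auto
      have "u \<otimes> b = u \<otimes> b' \<or> v \<otimes> b = v \<otimes> b'"
        using mem h u(2) v(2) q by auto
      then show "(v \<otimes> u) \<otimes> b = (v \<otimes> u) \<otimes> b'"
        using b SR[OF u(1)] SR[OF v(1)] by (metis m_assoc m_comm)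
    qed
    then have "\<forall>(z, w)\<in>insert q P. ?h z = ?h w \<longrightarrow> (v \<otimes> u) \<otimes> snd z = (v \<otimes> u) \<otimes> snd w"
      by (auto split: prod.splits)
    then show ?case
      using u(1) v(1) by (intro bexI[of _ "v \<otimes> u"]) auto
  qed
  let ?E = "Poly_Mapping.keys e"
  obtain u where u: "u \<in> S" "\<forall>(z, w)\<in>?E \<times> ?E. ?h z = ?h w \<longrightarrow> u \<otimes> snd z = u \<otimes> snd w"
    using merge[OF finite_cartesian_product[OF finite_keys finite_keys] Sigma_mono[OF e e]]
    by (elim bexE)
  have u_merge: "(case z of (x, y) \<Rightarrow> (x, u \<otimes> y)) = (case w of (x, y) \<Rightarrow> (x, u \<otimes> y))"
    if "z \<in> ?E" "w \<in> ?E" "?h z = ?h w" for z w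
    using bspec[OF u(2), of "(z, w)"] that by (cases z; cases w) auto
  \<comment> \<open>\<open>g\<close> lifts a symbol to some preimage in the support of
    \<open>e\<close> and multiplies by \<open>u\<close>; by \<open>u_merge\<close> the choice of
    preimage does not matter.\<close>
  define g where "g t = (case inv_into ?E ?h t of (x, y) \<Rightarrow> (x, u \<otimes> y))" for t
  have "times_right u e = frag_map (\<lambda>z. g (?h z)) e"
  proof (rule frag_extend_eq)
    fix z assume z: "z \<in> ?E"
    have "inv_into ?E ?h (?h z) \<in> ?E" "?h (inv_into ?E ?h (?h z)) = ?h z"
      using z by (auto intro: inv_into_into f_inv_into_f simp del: split_paired_All)
    from u_merge[OF this(1) z this(2)]
    show "frag_of (case z of (x, y) \<Rightarrow> (x, u \<otimes> y)) = frag_of (g (?h z))"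
      by (simp add: g_def)
  qed
  also have "\<dots> = frag_map g (divide_right S s e)"
    by (rule frag_map_comp[symmetric])
  finally show thesis
    using that[OF u(1)] zero by simp
qed

text \<open>With \<open>D\<close> the relations of \<open>M \<otimes> R\<close>, this shows that the relations of \<open>M \<otimes> S\<^sup>-\<^sup>1R\<close> are those
  of \<open>M \<otimes> R\<close> divided by a common denominator.\<close>

lemma divide_right_diff_closed:
  assumes S: "submonoid S R" and D: "\<And>d. d \<in> D \<Longrightarrow> Poly_Mapping.keys d \<subseteq> B \<times> carrier R"
    and diff: "\<And>c d. c \<in> D \<Longrightarrow> d \<in> D \<Longrightarrow> c - d \<in> D"
    and times: "\<And>u d. u \<in> S \<Longrightarrow> d \<in> D \<Longrightarrow> times_right u d \<in> D"
    and c: "c \<in> {divide_right S s d | s d. s \<in> S \<and> d \<in> D}" and c': "c' \<in> {divide_right S s d | s d. s \<in> S \<and> d \<in> D}"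
  shows "c - c' \<in> {divide_right S s d | s d. s \<in> S \<and> d \<in> D}"
proof -
  obtain s d t d' where *: "s \<in> S" "d \<in> D" "c = divide_right S s d" "t \<in> S" "d' \<in> D" "c' = divide_right S t d'"
    using c c' by blast
  have "c = divide_right S (s \<otimes> t) (times_right t d)"
    using divide_right_times_right[OF S D[OF *(2)] *(1,4)] *(3) by simp
  moreover have "s \<otimes> t = t \<otimes> s"
    using *(1,4) submonoid.subset[OF S] by (auto intro: m_comm)
  then have "c' = divide_right S (s \<otimes> t) (times_right s d')"
    unfolding *(6) by (rule ssubst) (rule divide_right_times_right[OF S D[OF *(5)] *(4,1), symmetric])
  ultimately have "c - c' = divide_right S (s \<otimes> t) (times_right t d - times_right s d')"
    by (simp add: frag_extend_diff)
  moreover have "times_right t d - times_right s d' \<in> D"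
    using * by (intro diff times)
  ultimately show ?thesis
    using submonoid.m_closed[OF S *(1,4)] by blast
qed

text \<open>\<open>K\<close> is the base ring and \<open>R\<close> the algebra being localized.
  Write \<open>c\<close> as \<open>d / s\<close> and its image as \<open>e / t\<close> with
  \<open>e\<close> a relation over \<open>R\<close>. After multiplication by some \<open>u\<close>
  in \<open>S\<close> this becomes an identity of formal sums over \<open>R\<close>; flatness makes
  \<open>u t d\<close> a relation, and dividing by \<open>s t u\<close> returns to
  \<open>c\<close>.\<close>

lemma flat_module_localization:
  fixes K :: "('d, 'r) ring_scheme" and \<phi> :: "'d \<Rightarrow> 'a"
  assumes S: "submonoid S R" and K: "cring K" and \<phi>: "\<phi> \<in> ring_hom K R"
    and flat: "flat_module TYPE('m) TYPE('k) K (scalar_restriction \<phi> R)"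
  shows "flat_module TYPE('m) TYPE('k) K (scalar_restriction (loc_map R S \<circ> \<phi>) (localization R S))"
proof -
  let ?A = "scalar_restriction \<phi> R"
  let ?L = "scalar_restriction (loc_map R S \<circ> \<phi>) (localization R S)"
  note [simp] = submonoid.one_closed[OF S] submonoid.m_closed[OF S]
  have SR: "u \<in> carrier R" if "u \<in> S" for u
    using that submonoid.subset[OF S] by auto
  have cA [simp]: "carrier ?A = carrier R" and cL [simp]: "carrier ?L = carrier (localization R S)"
    by (simp_all add: scalar_restriction_def)
  have A: "module K ?A"
    by (rule module_scalar_restriction[OF K is_cring \<phi>])
  have L: "module K ?L"
    by (rule module_scalar_restriction[OF K cring_localization[OF S]
          ring_hom_trans[OF \<phi> loc_map_ring_hom[OF S]]])
  have times_mem: "times_right u d \<in> tensor_subgroup K M ?A"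
    if "module K M" "u \<in> S" "d \<in> tensor_subgroup K M ?A" for u d and M :: "('d, 'c) module"
    by (rule tensor_subgroup_map_right[OF that(1) A A module_hom_mult[OF \<phi> SR[OF that(2)]] that(3)])
  have divide_right_mem: "divide_right S s d \<in> tensor_subgroup K M ?L"
    if "module K M" "s \<in> S" "d \<in> tensor_subgroup K M ?A" for s d and M :: "('d, 'c) module"
    by (rule tensor_subgroup_map_right[OF that(1) A L module_hom_loc_frac[OF S \<phi> that(2)] that(3)])
  have frags: "Poly_Mapping.keys d \<subseteq> carrier M \<times> carrier R"
    if "module K M" "d \<in> tensor_subgroup K M ?A" for d and M :: "('d, 'c) module"
    using tensor_subgroup_frags[OF that(1) A] that(2) by auto
  have common_rel: "tensor_subgroup K M ?L \<subseteq> {divide_right S s d | s d. s \<in> S \<and> d \<in> tensor_subgroup K M ?A}"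
    if M: "module K M" for M :: "('d, 'c) module"
  proof (rule tensor_subgroup_least[OF M L])
    show "0 \<in> {divide_right S s d | s d. s \<in> S \<and> d \<in> tensor_subgroup K M ?A}"
      by (intro CollectI exI[of _ \<one>] exI[of _ 0]) (simp add: tensor_subgroup_zero)
    show "c - d \<in> {divide_right S s d | s d. s \<in> S \<and> d \<in> tensor_subgroup K M ?A}"
      if "c \<in> {divide_right S s d | s d. s \<in> S \<and> d \<in> tensor_subgroup K M ?A}"
        "d \<in> {divide_right S s d | s d. s \<in> S \<and> d \<in> tensor_subgroup K M ?A}" for c d
      using that frags[OF M] tensor_subgroup_diff[OF M A] times_mem[OF M]
      by (intro divide_right_diff_closed[OF S, of _ "carrier M"]) blast+
    show "tensor_relations K M ?L \<subseteq> {divide_right S s d | s d. s \<in> S \<and> d \<in> tensor_subgroup K M ?A}"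
    proof
      fix c assume "c \<in> tensor_relations K M ?L"
      then have "\<exists>s d. c = divide_right S s d \<and> s \<in> S \<and> d \<in> tensor_relations K M ?A"
      proof (cases rule: tensor_relations_cases)
        case (left x x' y)
        then obtain a s where y: "y = loc_frac R S a s" "a \<in> carrier R" "s \<in> S"
          by (auto simp: carrier_localization)
        show ?thesis
          using left y tensor_relation_left[of x M x' a ?A K]
          by (intro exI[of _ s] exI[of _ "frag_of (x \<oplus>\<^bsub>M\<^esub> x', a) - frag_of (x, a) - frag_of (x', a)"])
            (simp add: frag_extend_diff)
      next
        case (right x y y')
        then obtain a s b t where y: "y = loc_frac R S a s" "a \<in> carrier R" "s \<in> S"
            "y' = loc_frac R S b t" "b \<in> carrier R" "t \<in> S"
          by (auto simp: carrier_localization)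
        \<comment> \<open>The sum of two fractions has denominator \<open>s \<otimes> t\<close>, so
          both summands are expanded to that denominator before the relation is lifted.\<close>
        have "y = loc_frac R S (a \<otimes> t) (s \<otimes> t)" "y' = loc_frac R S (b \<otimes> s) (s \<otimes> t)"
          unfolding y(1,4) using y(2,3,5,6) SR[OF y(3)] SR[OF y(6)]
          by (intro loc_frac_eqI[OF S]; simp add: m_ac)+
        moreover have "y \<oplus>\<^bsub>?L\<^esub> y' = loc_frac R S (a \<otimes> t \<oplus> b \<otimes> s) (s \<otimes> t)"
          unfolding y using y(2,3,5,6) by (simp add: scalar_restriction_def loc_add_frac[OF S])
        moreover have "frag_of (x, a \<otimes> t \<oplus> b \<otimes> s) - frag_of (x, a \<otimes> t) - frag_of (x, b \<otimes> s)
            \<in> tensor_relations K M ?A"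
          using tensor_relation_right[of x M "a \<otimes> t" ?A "b \<otimes> s" K] right(1) y(2,3,5,6) SR
          by (simp add: scalar_restriction_def)
        ultimately show ?thesis
          using right y(3,6)
          by (intro exI[of _ "s \<otimes> t"] exI[of _ "frag_of (x, a \<otimes> t \<oplus> b \<otimes> s) - frag_of (x, a \<otimes> t) - frag_of (x, b \<otimes> s)"])
            (simp add: frag_extend_diff)
      next
        case (smult r x y)
        then obtain a s where y: "y = loc_frac R S a s" "a \<in> carrier R" "s \<in> S"
          by (auto simp: carrier_localization)
        have "r \<odot>\<^bsub>?L\<^esub> y = loc_frac R S (\<phi> r \<otimes> a) s"
          using y smult(1) SR[OF y(3)] ring_hom_closed[OF \<phi>]
          by (simp add: scalar_restriction_def loc_map_def loc_mult_frac[OF S])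
        moreover have "frag_of (r \<odot>\<^bsub>M\<^esub> x, a) - frag_of (x, \<phi> r \<otimes> a) \<in> tensor_relations K M ?A"
          using tensor_relation_smult[of r K x M a ?A] smult(1,2) y(2)
          by (simp add: scalar_restriction_def)
        ultimately show ?thesis
          using smult y
          by (intro exI[of _ s] exI[of _ "frag_of (r \<odot>\<^bsub>M\<^esub> x, a) - frag_of (x, \<phi> r \<otimes> a)"])
            (simp add: frag_extend_diff)
      qed
      then show "c \<in> {divide_right S s d | s d. s \<in> S \<and> d \<in> tensor_subgroup K M ?A}"
        using tensor_relations_subgroup by blast
    qed
  qed
  \<comment> \<open>The same closure argument as for relations, now for arbitrary formal sums:
    finitely many fractions have a common denominator.\<close>
  have common_frag: "\<exists>s\<in>S. \<exists>d. Poly_Mapping.keys d \<subseteq> B \<times> carrier R \<and> c = divide_right S s d"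
    if "Poly_Mapping.keys c \<subseteq> B \<times> carrier (localization R S)" for B :: "'c set" and c
  proof -
    have "c \<in> {divide_right S s d | s d. s \<in> S \<and> d \<in> {d. Poly_Mapping.keys d \<subseteq> B \<times> carrier R}}"
      using that
    proof (induction c rule: free_Abelian_group_induct[consumes 1, case_names zero diff single])
      case zero
      show ?case
        by (intro CollectI exI[of _ \<one>] exI[of _ 0]) simp
    next
      case (diff c d)
      show ?case
      proof (rule divide_right_diff_closed[OF S _ _ _ diff(3,4), of B])
        show "c - d \<in> {d. Poly_Mapping.keys d \<subseteq> B \<times> carrier R}"
          if "c \<in> {d. Poly_Mapping.keys d \<subseteq> B \<times> carrier R}"
            "d \<in> {d. Poly_Mapping.keys d \<subseteq> B \<times> carrier R}" for c d :: "'c \<times> 'a \<Rightarrow>\<^sub>0 int"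
          using keys_diff[of c d] that by blast
        show "times_right u d \<in> {d. Poly_Mapping.keys d \<subseteq> B \<times> carrier R}"
          if "u \<in> S" "d \<in> {d. Poly_Mapping.keys d \<subseteq> B \<times> carrier R}" for u d
          using keys_times_right[OF _ SR[OF that(1)]] that(2) by blast
      qed simp
    next
      case (single a)
      then obtain x y s where "a = (x, loc_frac R S y s)" "x \<in> B" "y \<in> carrier R" "s \<in> S"
        by (auto simp: carrier_localization)
      then show ?case
        by (intro CollectI exI[of _ s] exI[of _ "frag_of (x, y)"]) simp
    qed
    then show ?thesis by blast
  qed
  show ?thesis
    unfolding flat_module_iff
  proof (intro conjI allI impI L)
    fix M :: "('d, 'm) module" and M' :: "('d, 'k) module" and f c
    assume M: "module K M" and M': "module K M'" and f: "f \<in> module_hom K M M'"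
      and inj: "inj_on f (carrier M)" and c: "c \<in> tensor_frags M ?L"
      and fc: "frag_map (\<lambda>(x, y). (f x, y)) c \<in> tensor_subgroup K M' ?L"
    let ?f = "\<lambda>c. frag_map (\<lambda>(x, y). (f x, y)) c"
    obtain s d where s: "s \<in> S" and d: "Poly_Mapping.keys d \<subseteq> carrier M \<times> carrier R"
      and c_eq: "c = divide_right S s d"
      using common_frag[of c "carrier M"] c by auto
    obtain t e where t: "t \<in> S" and e: "e \<in> tensor_subgroup K M' ?A"
      and fc_eq: "frag_map (\<lambda>(x, y). (f x, y)) c = divide_right S t e"
      using common_rel[OF M'] fc by blast
    have f_keys: "Poly_Mapping.keys (?f d) \<subseteq> carrier M' \<times> carrier R" if "Poly_Mapping.keys d \<subseteq> carrier M \<times> carrier R" for d :: "'m \<times> 'a \<Rightarrow>\<^sub>0 int"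
      using keys_frag_map[of "\<lambda>(x, y). (f x, y)" d] that f by (force simp: module_hom_def)
    have f_times: "?f (times_right u d) = times_right u (?f d)" for u and d :: "'m \<times> 'a \<Rightarrow>\<^sub>0 int"
      unfolding frag_map_comp by (rule frag_extend_eq) auto
    have "?f c = divide_right S s (?f d)"
      unfolding c_eq frag_map_comp by (rule frag_extend_eq) auto
    also have "\<dots> = divide_right S (s \<otimes> t) (times_right t (?f d))"
      by (rule divide_right_times_right[OF S f_keys[OF d] s t, symmetric])
    finally have 1: "?f c = divide_right S (s \<otimes> t) (times_right t (?f d))" .
    have "?f c = divide_right S (t \<otimes> s) (times_right s e)"
      unfolding fc_eq by (rule divide_right_times_right[OF S frags[OF M' e] t s, symmetric])
    with 1 have "divide_right S (s \<otimes> t) (times_right t (?f d) - times_right s e) = 0"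
      using m_comm[OF SR[OF s] SR[OF t]] by (simp add: frag_extend_diff)
    moreover have "Poly_Mapping.keys (times_right t (?f d) - times_right s e) \<subseteq> carrier M' \<times> carrier R"
      using keys_times_right[OF f_keys[OF d] SR[OF t]] keys_times_right[OF frags[OF M' e] SR[OF s]]
        keys_diff[of "times_right t (?f d)" "times_right s e"] by blast
    \<comment> \<open>Equal formal sums of fractions come from equal formal sums over
      \<open>R\<close> only after one more multiplication by an element of \<open>S\<close>.\<close>
    ultimately obtain u where u: "u \<in> S" "times_right u (times_right t (?f d) - times_right s e) = 0"
      using divide_right_eq_zero[OF S, of _ "carrier M'" "s \<otimes> t"] s t by auto
    then have "?f (times_right u (times_right t d)) = times_right u (times_right s e)"
      by (simp add: frag_extend_diff f_times)
    also have "\<dots> \<in> tensor_subgroup K M' ?A"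
      by (intro times_mem[OF M'] u(1) s e)
    finally have "times_right u (times_right t d) \<in> tensor_subgroup K M ?A"
      using flat M M' f inj keys_times_right[OF keys_times_right[OF d SR[OF t]] SR[OF u(1)]]
      unfolding flat_module_iff by simp
    then have "divide_right S (s \<otimes> t \<otimes> u) (times_right u (times_right t d)) \<in> tensor_subgroup K M ?L"
      using s t u(1) by (intro divide_right_mem[OF M]) simp_all
    also have "divide_right S (s \<otimes> t \<otimes> u) (times_right u (times_right t d)) = divide_right S (s \<otimes> t) (times_right t d)"
      using s t u(1) by (intro divide_right_times_right[OF S keys_times_right[OF d SR[OF t]]]) simp_all
    also have "\<dots> = c"
      unfolding c_eq by (rule divide_right_times_right[OF S d s t])
    finally show "c \<in> tensor_subgroup K M ?L" .
  qed
qed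

end

section \<open>Flatness of the power series ring\<close>

lemma finsum_scalar_restriction: "finsum (scalar_restriction \<phi> A) = finsum A"
  by (intro ext) (simp add: finsum_def finprod_def scalar_restriction_def)

text \<open>The dual basis consists of the coefficient functionals, which are linear because
  constants act coefficientwise, and the series from \<open>ps_decomposition\<close>.\<close>

lemma (in noetherian_cring) flat_module_ps_ring:
  "flat_module TYPE('m) TYPE('k) R (scalar_restriction (ps_const R) (ps_ring R))"
proof (rule flat_module_if_locally_projective)
  let ?N = "scalar_restriction (ps_const R) (ps_ring R)"
  show "cring R" ..
  show "module R ?N"
    by (rule module_scalar_restriction[OF is_cring cring_ps_ring ps_const_ring_hom])
  fix Y assume Y: "finite Y" "Y \<subseteq> carrier ?N"
  have "Y \<subseteq> carrier (ps_ring R)"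
    using Y(2) by (simp add: scalar_restriction_def)
  with Y(1) show "\<exists>(K :: nat set) \<epsilon> z. finite K \<and> (\<forall>k. \<epsilon> k \<in> module_hom R ?N (scalar_restriction id R)) \<and>
      z \<in> K \<rightarrow> carrier ?N \<and> (\<forall>y\<in>Y. y = (\<Oplus>\<^bsub>?N\<^esub>k\<in>K. \<epsilon> k y \<odot>\<^bsub>?N\<^esub> z k))"
  proof (rule ps_decomposition)
    fix z and N :: nat
    assume z: "\<And>k. z k \<in> carrier (ps_ring R)"
      "\<And>y. y \<in> Y \<Longrightarrow> y = (\<Oplus>\<^bsub>ps_ring R\<^esub>k\<in>{..N}. ps_const R (y k) \<otimes>\<^bsub>ps_ring R\<^esub> z k)"
    have "(\<lambda>y. y k) \<in> module_hom R ?N (scalar_restriction id R)" for k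
      by (auto simp: module_hom_def scalar_restriction_def ps_carrier_iff ps_add_nth ps_const_mult_nth)
    moreover have "y = (\<Oplus>\<^bsub>?N\<^esub>k\<in>{..N}. y k \<odot>\<^bsub>?N\<^esub> z k)" if "y \<in> Y" for y
      unfolding finsum_scalar_restriction using z(2)[OF that] by (simp add: scalar_restriction_def)
    moreover have "z \<in> {..N} \<rightarrow> carrier ?N"
      using z(1) by (auto simp: scalar_restriction_def)
    ultimately show ?thesis
      by (intro exI[of _ "{..N}"] exI[of _ "\<lambda>k y. y k"] exI[of _ z] conjI ballI allI finite_atMost)
  qed
qed


section \<open>Ideals of a localization\<close>

text \<open>For the inclusion from right to left, the preimage under \<open>\<psi>\<close> of the
  ideal extended in one step is an ideal of \<open>A\<close> containing the image of
  \<open>p\<close>, hence the intermediate extension.\<close>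

lemma extended_ideal_comp:
  assumes A: "ring A" and B: "ring B" and \<psi>: "\<psi> \<in> ring_hom A B" and p: "\<phi> ` p \<subseteq> carrier A"
  shows "extended_ideal (\<psi> \<circ> \<phi>) B p = extended_ideal \<psi> B (extended_ideal \<phi> A p)"
proof
  interpret \<psi>: ring_hom_ring A B \<psi>
    using A B \<psi> by (rule ring_hom_ringI2)
  let ?E = "extended_ideal \<phi> A p"
  have E: "ideal ?E A"
    unfolding extended_ideal_def by (rule \<psi>.R.genideal_ideal[OF p])
  have sub: "\<phi> ` p \<subseteq> ?E"
    unfolding extended_ideal_def by (rule \<psi>.R.genideal_self[OF p])
  have EB: "\<psi> ` ?E \<subseteq> carrier B"
    using ideal.Icarr[OF E] by auto
  have pB: "(\<psi> \<circ> \<phi>) ` p \<subseteq> carrier B"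
    using EB sub by auto
  show "extended_ideal (\<psi> \<circ> \<phi>) B p \<subseteq> extended_ideal \<psi> B ?E"
    unfolding extended_ideal_def[of "\<psi> \<circ> \<phi>"] extended_ideal_def[of \<psi>]
    using EB sub by (intro \<psi>.S.subset_Idl_subset) auto
  let ?J = "extended_ideal (\<psi> \<circ> \<phi>) B p"
  have J: "ideal ?J B"
    unfolding extended_ideal_def by (rule \<psi>.S.genideal_ideal[OF pB])
  have "(\<psi> \<circ> \<phi>) ` p \<subseteq> ?J"
    unfolding extended_ideal_def by (rule \<psi>.S.genideal_self[OF pB])
  then have "\<phi> ` p \<subseteq> {a \<in> carrier A. \<psi> a \<in> ?J}"
    using p by auto
  then have "?E \<subseteq> {a \<in> carrier A. \<psi> a \<in> ?J}"
    unfolding extended_ideal_def[of \<phi>]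
    using \<psi>.ideal_vimage[OF J] by (intro \<psi>.R.genideal_minimal)
  then show "extended_ideal \<psi> B ?E \<subseteq> ?J"
    unfolding extended_ideal_def[of \<psi>] by (intro \<psi>.S.genideal_minimal J) auto
qed

lemma (in cring) submonoid_compl_primes:
  assumes "\<And>i. i \<in> I \<Longrightarrow> primeideal (P i) R"
  shows "submonoid (carrier R - (\<Union>i\<in>I. P i)) R"
proof
  show "\<one> \<in> carrier R - (\<Union>i\<in>I. P i)"
    using assms ideal.one_imp_carrier primeideal.axioms(1) primeideal.I_notcarr by fastforce
  show "x \<otimes> y \<in> carrier R - (\<Union>i\<in>I. P i)"
    if "x \<in> carrier R - (\<Union>i\<in>I. P i)" "y \<in> carrier R - (\<Union>i\<in>I. P i)" for x y
    using that assms primeideal.I_prime by fastforce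
qed auto

context cring
begin

text \<open>Common denominators make the fractions with numerator in \<open>P\<close> closed under
  sums, so they form an ideal; conversely \<open>a / s\<close> is the multiple of
  \<open>a / 1\<close> by \<open>1 / s\<close>.\<close>

lemma extended_ideal_localization:
  assumes S: "submonoid S R" and P: "ideal P R"
  shows "extended_ideal (loc_map R S) (localization R S) P = {loc_frac R S a s | a s. a \<in> P \<and> s \<in> S}"
proof -
  interpret P: ideal P R by fact
  interpret L: cring "localization R S" by (rule cring_localization[OF S])
  note [simp] = submonoid.one_closed[OF S] submonoid.m_closed[OF S]
  have SR: "s \<in> carrier R" if "s \<in> S" for s
    using that submonoid.subset[OF S] by auto
  let ?L = "localization R S"
  let ?J = "{loc_frac R S a s | a s. a \<in> P \<and> s \<in> S}"
  have JL: "?J \<subseteq> carrier ?L"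
    using P.Icarr unfolding carrier_localization by blast
  have map: "loc_map R S ` P \<subseteq> carrier ?L"
    using P.Icarr ring_hom_closed[OF loc_map_ring_hom[OF S]] by auto
  interpret E: ideal "extended_ideal (loc_map R S) ?L P" ?L
    unfolding extended_ideal_def by (rule L.genideal_ideal[OF map])
  have mult: "x \<otimes>\<^bsub>?L\<^esub> y \<in> ?J" if x: "x \<in> carrier ?L" and y: "y \<in> ?J" for x y
  proof -
    obtain a s b t where *: "x = loc_frac R S a s" "a \<in> carrier R" "s \<in> S"
        "y = loc_frac R S b t" "b \<in> P" "t \<in> S"
      using x y unfolding carrier_localization by blast
    have "x \<otimes>\<^bsub>?L\<^esub> y = loc_frac R S (a \<otimes> b) (s \<otimes> t)"
      using * P.Icarr by (simp add: loc_mult_frac[OF S])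
    moreover have "a \<otimes> b \<in> P" "s \<otimes> t \<in> S"
      using * by (auto intro: P.I_l_closed)
    ultimately show ?thesis by blast
  qed
  show ?thesis
  proof
    have "ideal ?J ?L"
    proof (rule idealI)
      show "subgroup ?J (add_monoid ?L)"
      proof (rule L.add.subgroupI[OF JL])
        show "?J \<noteq> {}"
          using P.zero_closed submonoid.one_closed[OF S] by blast
      next
        fix x assume x: "x \<in> ?J"
        then have "x \<in> carrier ?L"
          using JL by blast
        then have "\<ominus>\<^bsub>?L\<^esub> x = \<ominus>\<^bsub>?L\<^esub> \<one>\<^bsub>?L\<^esub> \<otimes>\<^bsub>?L\<^esub> x"
          by (simp add: L.l_minus)
        then show "\<ominus>\<^bsub>?L\<^esub> x \<in> ?J"
          using mult[OF _ x, of "\<ominus>\<^bsub>?L\<^esub> \<one>\<^bsub>?L\<^esub>"] by simp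
      next
        fix x y assume "x \<in> ?J" "y \<in> ?J"
        then obtain a s b t where *: "x = loc_frac R S a s" "a \<in> P" "s \<in> S"
            "y = loc_frac R S b t" "b \<in> P" "t \<in> S"
          by blast
        have "x \<oplus>\<^bsub>?L\<^esub> y = loc_frac R S (a \<otimes> t \<oplus> b \<otimes> s) (s \<otimes> t)"
          using * P.Icarr by (simp add: loc_add_frac[OF S])
        moreover have "a \<otimes> t \<oplus> b \<otimes> s \<in> P" "s \<otimes> t \<in> S"
          using * SR by (auto intro!: P.I_r_closed additive_subgroup.a_closed[OF P.additive_subgroup_axioms])
        ultimately show "x \<oplus>\<^bsub>?L\<^esub> y \<in> ?J" by blast
      qed
      fix x y assume xy: "x \<in> ?J" "y \<in> carrier ?L"
      then show "y \<otimes>\<^bsub>?L\<^esub> x \<in> ?J" by (intro mult)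
      then show "x \<otimes>\<^bsub>?L\<^esub> y \<in> ?J"
        using xy JL by (subst L.m_comm) auto
    qed (rule L.ring_axioms)
    moreover have "loc_map R S ` P \<subseteq> ?J"
      unfolding loc_map_def using submonoid.one_closed[OF S] by blast
    ultimately show "extended_ideal (loc_map R S) ?L P \<subseteq> ?J"
      unfolding extended_ideal_def by (rule L.genideal_minimal)
    show "?J \<subseteq> extended_ideal (loc_map R S) ?L P"
    proof clarify
      fix a s assume a: "a \<in> P" and s: "s \<in> S"
      have "loc_map R S a \<in> extended_ideal (loc_map R S) ?L P"
        unfolding extended_ideal_def using L.genideal_self[OF map] a by auto
      moreover have "loc_frac R S \<one> s \<in> carrier ?L"
        using s by (auto simp: carrier_localization)
      ultimately have "loc_frac R S \<one> s \<otimes>\<^bsub>?L\<^esub> loc_map R S a \<in> extended_ideal (loc_map R S) ?L P"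
        by (intro E.I_l_closed)
      then show "loc_frac R S a s \<in> extended_ideal (loc_map R S) ?L P"
        using a s P.Icarr[OF a] SR[OF s] by (simp add: loc_map_def loc_mult_frac[OF S])
    qed
  qed
qed

text \<open>A proper ideal of the localization contracts to an ideal missing \<open>S\<close>, which
  \<open>avoid\<close> places inside one \<open>P i\<close>. So every proper ideal lies in the
  extension of some \<open>P i\<close>. These extensions contract back to the incomparable
  \<open>P i\<close>, so none lies in another.\<close>

lemma maximalideals_localization:
  assumes prime: "\<And>i. i \<in> I \<Longrightarrow> primeideal (P i) R"
    and incomparable: "\<And>i j. i \<in> I \<Longrightarrow> j \<in> I \<Longrightarrow> P i \<subseteq> P j \<Longrightarrow> i = j"
    and avoid: "\<And>Q. ideal Q R \<Longrightarrow> Q \<subseteq> (\<Union>i\<in>I. P i) \<Longrightarrow> \<exists>i\<in>I. Q \<subseteq> P i"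
    and S_def: "S = carrier R - (\<Union>i\<in>I. P i)"
  shows "{J. maximalideal J (localization R S)} =
    {extended_ideal (loc_map R S) (localization R S) (P i) | i. i \<in> I}"
proof -
  have S: "submonoid S R"
    unfolding S_def using prime by (rule submonoid_compl_primes)
  let ?L = "localization R S"
  let ?E = "\<lambda>i. extended_ideal (loc_map R S) ?L (P i)"
  interpret L: cring ?L by (rule cring_localization[OF S])
  interpret \<psi>: ring_hom_ring R ?L "loc_map R S"
    using ring_axioms L.ring_axioms loc_map_ring_hom[OF S] by (rule ring_hom_ringI2)
  note [simp] = submonoid.one_closed[OF S] submonoid.m_closed[OF S]
  have SR: "s \<in> carrier R" if "s \<in> S" for s
    using that by (simp add: S_def)
  have E_eq: "?E i = {loc_frac R S a s | a s. a \<in> P i \<and> s \<in> S}" if "i \<in> I" for i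
    by (rule extended_ideal_localization[OF S primeideal.axioms(1)[OF prime[OF that]]])
  have E_ideal: "ideal (?E i) ?L" if i: "i \<in> I" for i
  proof -
    have "loc_map R S ` P i \<subseteq> carrier ?L"
      using ideal.Icarr[OF primeideal.axioms(1)[OF prime[OF i]]] by auto
    then show ?thesis
      unfolding extended_ideal_def by (rule L.genideal_ideal)
  qed
  \<comment> \<open>Contraction undoes extension here: \<open>P i\<close> is prime and disjoint from
    \<open>S\<close>, so a denominator can be cancelled from a product in
    \<open>P i\<close>.\<close>
  have E_mem: "a \<in> P i" if i: "i \<in> I" and a: "a \<in> carrier R" and mem: "loc_map R S a \<in> ?E i" for a i
  proof -
    interpret P: primeideal "P i" R by (rule prime[OF i])
    obtain b t where bt: "loc_frac R S a \<one> = loc_frac R S b t" "b \<in> P i" "t \<in> S"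
      using mem unfolding E_eq[OF i] loc_map_def by auto
    obtain u where u: "u \<in> S" "u \<otimes> (a \<otimes> t \<ominus> b \<otimes> \<one>) = \<zero>"
      using bt a P.Icarr[OF bt(2)] by (auto simp: loc_frac_eq_iff[OF S])
    note c = a SR[OF bt(3)] SR[OF u(1)] P.Icarr[OF bt(2)]
    have "(u \<otimes> t) \<otimes> a = u \<otimes> (a \<otimes> t \<ominus> b \<otimes> \<one>) \<oplus> u \<otimes> b"
      using c by algebra
    then have "(u \<otimes> t) \<otimes> a \<in> P i"
      using u(2) c P.I_l_closed[OF bt(2) c(3)] by simp
    moreover have "u \<otimes> t \<in> S"
      using u(1) bt(3) by simp
    ultimately show "a \<in> P i"
      using P.I_prime[of "u \<otimes> t" a] c i by (auto simp: S_def)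
  qed
  have E_proper: "?E i \<noteq> carrier ?L" if i: "i \<in> I" for i
  proof
    assume "?E i = carrier ?L"
    then have "\<one> \<in> P i"
      using E_mem[OF i one_closed] \<psi>.hom_closed[OF one_closed] by blast
    then show False
      using S submonoid.one_closed[OF S] i by (auto simp: S_def)
  qed
  have below: "\<exists>i\<in>I. J \<subseteq> ?E i" if J: "ideal J ?L" and proper: "J \<noteq> carrier ?L" for J
  proof -
    interpret J: ideal J ?L by fact
    let ?Q = "{a \<in> carrier R. loc_map R S a \<in> J}"
    \<comment> \<open>Elements of \<open>S\<close> become units, so a proper ideal cannot contain
      their images.\<close>
    have "a \<notin> S" if "a \<in> ?Q" for a
    proof
      assume aS: "a \<in> S"
      have "loc_frac R S \<one> a \<otimes>\<^bsub>?L\<^esub> loc_map R S a \<in> J"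
        using that aS by (intro J.I_l_closed) (auto simp: carrier_localization)
      moreover have "loc_frac R S \<one> a \<otimes>\<^bsub>?L\<^esub> loc_map R S a = loc_frac R S a a"
        using aS SR[OF aS] by (simp add: loc_map_def loc_mult_frac[OF S])
      moreover have "loc_frac R S a a = \<one>\<^bsub>?L\<^esub>"
        using aS SR[OF aS] by (simp add: localization_def) (rule loc_frac_eqI[OF S]; simp)
      ultimately show False
        using J.one_imp_carrier proper by simp
    qed
    then have "?Q \<subseteq> (\<Union>i\<in>I. P i)"
      by (auto simp: S_def)
    then obtain i where i: "i \<in> I" "?Q \<subseteq> P i"
      using avoid[OF \<psi>.ideal_vimage[OF J]] by blast
    have "x \<in> ?E i" if x: "x \<in> J" for x
    proof -
      obtain a s where as: "x = loc_frac R S a s" "a \<in> carrier R" "s \<in> S"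
        using J.Icarr[OF x] by (auto simp: carrier_localization)
      \<comment> \<open>Multiplying \<open>x\<close> by its denominator puts its numerator into the
        contraction of \<open>J\<close>.\<close>
      have "loc_map R S s \<otimes>\<^bsub>?L\<^esub> x \<in> J"
        using SR[OF as(3)] by (intro J.I_l_closed x \<psi>.hom_closed)
      moreover have "loc_map R S s \<otimes>\<^bsub>?L\<^esub> x = loc_frac R S (s \<otimes> a) s"
        using as SR[OF as(3)] by (simp add: loc_map_def loc_mult_frac[OF S])
      moreover have "loc_frac R S (s \<otimes> a) s = loc_map R S a"
        unfolding loc_map_def using as SR[OF as(3)] by (intro loc_frac_eqI[OF S]) (auto simp: m_comm)
      ultimately have "a \<in> P i"
        using i(2) as(2) by auto
      then show ?thesis
        unfolding E_eq[OF i(1)] using as by blast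
    qed
    with i(1) show ?thesis by blast
  qed
  show ?thesis
  proof (intro equalityI subsetI)
    fix J assume "J \<in> {J. maximalideal J ?L}"
    then interpret J: maximalideal J ?L by simp
    obtain i where i: "i \<in> I" "J \<subseteq> ?E i"
      using below[OF J.ideal_axioms] J.I_notcarr by metis
    then have "?E i = J"
      using J.I_maximal[OF E_ideal[OF i(1)] i(2)] ideal.Icarr[OF E_ideal[OF i(1)]] E_proper[OF i(1)]
      by blast
    with i(1) show "J \<in> {?E i | i. i \<in> I}" by blast
  next
    fix J assume "J \<in> {?E i | i. i \<in> I}"
    then obtain i where i: "i \<in> I" "J = ?E i" by blast
    have "maximalideal (?E i) ?L"
    proof (rule maximalidealI[OF E_ideal[OF i(1)]])
      show "carrier ?L \<noteq> ?E i"
        using E_proper[OF i(1)] by simp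
      fix J' assume J': "ideal J' ?L" "?E i \<subseteq> J'" "J' \<subseteq> carrier ?L"
      show "J' = ?E i \<or> J' = carrier ?L"
      proof (rule disjCI)
        assume "J' \<noteq> carrier ?L"
        then obtain j where j: "j \<in> I" "J' \<subseteq> ?E j"
          using below[OF J'(1)] by blast
        have "P i \<subseteq> P j"
        proof
          fix a assume a: "a \<in> P i"
          then have "a \<in> carrier R"
            using ideal.Icarr[OF primeideal.axioms(1)[OF prime[OF i(1)]]] by blast
          moreover have "loc_map R S a \<in> ?E i"
            unfolding E_eq[OF i(1)] loc_map_def using a submonoid.one_closed[OF S] by blast
          ultimately show "a \<in> P j"
            using E_mem[OF j(1)] J'(2) j(2) by blast
        qed
        with i(1) j(1) have "i = j" by (rule incomparable)
        with j(2) J'(2) show "J' = ?E i" by blast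
      qed
    qed
    with i(2) show "J \<in> {J. maximalideal J ?L}" by simp
  qed
qed

end


section \<open>The maximal ideals of the localized power series ring\<close>

text \<open>An arbitrary set of natural numbers as index set covers finite families together with
  countably infinite ones.\<close>

theorem lemma1p1:
  fixes R :: "('a, 'r) ring_scheme"
    and I :: "nat set"
    and p :: "nat \<Rightarrow> 'a set"
  assumes "cring R" and "noetherian_ring R"
    and "\<And>i. i \<in> I \<Longrightarrow> primeideal (p i) R"
    and "\<And>i j. i \<in> I \<Longrightarrow> j \<in> I \<Longrightarrow> i \<noteq> j \<Longrightarrow> \<not> p i \<subseteq> p j"
  defines "S \<equiv> carrier (ps_ring R) - (\<Union>i\<in>I. extended_ideal (ps_const R) (ps_ring R) (p i))"
  defines "T \<equiv> localization (ps_ring R) S"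
  defines "\<phi> \<equiv> loc_map (ps_ring R) S \<circ> ps_const R"
  shows "flat_extension TYPE('m) TYPE('k) \<phi> R T \<and>
         {J. maximalideal J T} = {extended_ideal \<phi> T (p i) | i. i \<in> I}"
proof -
  interpret noetherian_cring R
    using assms(1,2) by (rule noetherian_cring.intro)
  interpret A: cring "ps_ring R" by (rule cring_ps_ring)
  have p: "ideal (p i) R" if "i \<in> I" for i
    using assms(3)[OF that] by (rule primeideal.axioms(1))
  \<comment> \<open>With membership in the extended primes read off from coefficients,
    \<open>S\<close> is a complement of primes to which countable avoidance applies.\<close>
  have S_eq: "S = carrier (ps_ring R) - (\<Union>i\<in>I. ps_ideal (p i))"
    unfolding S_def using extended_ideal_ps_const[OF p] by auto
  have prime: "primeideal (ps_ideal (p i)) (ps_ring R)" if "i \<in> I" for i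
    using assms(3)[OF that] by (rule primeideal_ps_ideal)
  have S: "submonoid S (ps_ring R)"
    unfolding S_eq using prime by (rule A.submonoid_compl_primes)
  have "\<phi> \<in> ring_hom R T"
    unfolding \<phi>_def T_def by (rule ring_hom_trans[OF ps_const_ring_hom A.loc_map_ring_hom[OF S]])
  moreover have "flat_module TYPE('m) TYPE('k) R (scalar_restriction \<phi> T)"
    unfolding \<phi>_def T_def
    by (rule A.flat_module_localization[OF S is_cring ps_const_ring_hom flat_module_ps_ring])
  moreover have "{J. maximalideal J T} =
      {extended_ideal (loc_map (ps_ring R) S) T (ps_ideal (p i)) | i. i \<in> I}"
    unfolding T_def
  proof (rule A.maximalideals_localization[OF prime _ _ S_eq])
    fix i j assume ij: "i \<in> I" "j \<in> I" "ps_ideal (p i) \<subseteq> ps_ideal (p j)"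
    have "a \<in> p j" if "a \<in> p i" for a
    proof -
      \<comment> \<open>The series with every coefficient equal to \<open>a\<close> transfers the
        containment of power series ideals back to \<open>R\<close>.\<close>
      have "(\<lambda>_. a) \<in> ps_ideal (p j)"
        using ij(3) that by (auto simp: ps_ideal_def)
      then show ?thesis by (simp add: ps_ideal_def)
    qed
    then show "i = j"
      using assms(4)[OF ij(1,2)] by blast
  next
    fix Q assume "ideal Q (ps_ring R)" "Q \<subseteq> (\<Union>i\<in>I. ps_ideal (p i))"
    then show "\<exists>i\<in>I. Q \<subseteq> ps_ideal (p i)"
      using ps_countable_avoidance[of I p Q] p by blast
  qed
  moreover have "extended_ideal (loc_map (ps_ring R) S) T (ps_ideal (p i)) = extended_ideal \<phi> T (p i)"
    if "i \<in> I" for i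
  proof -
    have "ps_const R ` p i \<subseteq> carrier (ps_ring R)"
      using ideal.Icarr[OF p[OF that]] by (auto intro: ps_const_closed)
    then show ?thesis
      unfolding \<phi>_def T_def extended_ideal_ps_const[OF p[OF that], symmetric]
      by (rule extended_ideal_comp[OF A.ring_axioms cring.axioms(1)[OF A.cring_localization[OF S]]
            A.loc_map_ring_hom[OF S], symmetric])
  qed
  then have "{extended_ideal (loc_map (ps_ring R) S) T (ps_ideal (p i)) | i. i \<in> I} =
      {extended_ideal \<phi> T (p i) | i. i \<in> I}"
    by (intro Collect_cong) metis
  ultimately show ?thesis
    by (simp add: flat_extension_def)
qed

end
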